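(* Let $0<\alpha\le 1$ and $0\le\beta<1$. Consider functions $f\in\mathcal{S}(\alpha,\beta)$ such that $z/f(z)$ is a non-vanishing analytic function in $\mathbb{D}$. Then for every $\rho$ with $0<\rho\le 1$, $$\max_{f\in\mathcal{S}(\alpha,\beta)}\Delta\left(\rho,\frac{z}{f}\right)=4\pi\alpha^2(1-\beta)^2\rho^2\,{}_2F_1(2\beta-1,2\beta-1;2;\alpha^2\rho^2),$$ and the maximum is attained only by the rotations of the function $k_{\alpha,\beta}(z)=z(1-\alpha z)^{-2(1-\beta)}$, $z\in\mathbb{D}$.
   Context: $\mathbb{D}=\{z\in\mathbb{C}:|z|<1\}$ and $\mathbb{D}_r=\{z\in\mathbb{C}:|z|<r\}$. $\mathcal{A}$ is the family of functions $f$ analytic in $\mathbb{D}$ with $f(0)=0$ and $f'(0)=1$. For analytic $p,q$ in $\mathbb{D}$, $p\prec q$ ($p$ is subordinate to $q$) means $p(z)=q(w(z))$ in $\mathbb{D}$ for some analytic $w$ in $\mathbb{D}$ with $w(0)=0$ and $|w(z)|<1$. For $0<\alpha\le1$, $0\le\beta<1$, $\mathcal{S}(\alpha,\beta)$ is the class of $f\in\mathcal{A}$ such that for all $z\in\mathbb{D}$ $$\left|\left(\frac{zf'(z)}{f(z)}-1\right)\Big/\left(\frac{zf'(z)}{f(z)}+1-2\beta\right)\right|<\alpha,\quad\text{i.e.}\quad \frac{zf'(z)}{f(z)}\prec\frac{1+(1-2\beta)\alpha z}{1-\alpha z}$$ (with $zf'(z)/f(z)$ and $z/f(z)$ taken to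 be $1$ at $z=0$). For $g$ analytic in $\mathbb{D}$ and $0<r\le1$, $\Delta(r,g)=\iint_{\mathbb{D}_r}|g'(z)|^2\,dx\,dy$ ($z=x+iy$); $\Delta(\rho,z/f)$ means $\Delta(\rho,g)$ with $g(z)=z/f(z)$. A rotation of a function $k$ is a function $z\mapsto e^{-i\theta}k(e^{i\theta}z)$, $\theta\in\mathbb{R}$. The power $(1-\alpha z)^{-2(1-\beta)}$ is the branch equal to $1$ at $z=0$. ${}_2F_1(a,b;c;x)=1+\sum_{n\ge1}\frac{(a)_n(b)_n}{(c)_n(1)_n}x^n$ is the Gaussian hypergeometric series, where $(a)_0=1$, $(a)_n=a(a+1)\cdots(a+n-1)$; at $x=1$ (when $\alpha=\rho=1$) it denotes the sum of the series. *)

theory Defs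
  imports "HOL-Complex_Analysis.Complex_Analysis"
begin

abbreviation unit_disc :: "complex set" where
  "unit_disc \<equiv> ball 0 1"

definition class_A :: "(complex \<Rightarrow> complex) set" where
  "class_A = {f. f holomorphic_on unit_disc \<and> f 0 = 0 \<and> deriv f 0 = 1}"

text \<open>The values at the origin are those of the analytic continuations, for
  \<open>f\<close> normalized as in \<open>class_A\<close>.\<close>

definition log_quot :: "(complex \<Rightarrow> complex) \<Rightarrow> complex \<Rightarrow> complex" where
  "log_quot f z = (if z = 0 then 1 else z * deriv f z / f z)"

definition z_over :: "(complex \<Rightarrow> complex) \<Rightarrow> complex \<Rightarrow> complex" where
  "z_over f z = (if z = 0 then 1 else z / f z)"

text \<open>Since \<open>x / 0 = 0\<close> in HOL, the two denominators in the defining inequality are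
  explicitly required not to vanish.\<close>

definition class_S :: "real \<Rightarrow> real \<Rightarrow> (complex \<Rightarrow> complex) set" where
  "class_S \<alpha> \<beta> = {f \<in> class_A. \<forall>z\<in>unit_disc.
     (z \<noteq> 0 \<longrightarrow> f z \<noteq> 0) \<and>
     log_quot f z + 1 - 2 * of_real \<beta> \<noteq> 0 \<and>
     norm ((log_quot f z - 1) / (log_quot f z + 1 - 2 * of_real \<beta>)) < \<alpha>}"

text \<open>The Dirichlet area is taken in the extended nonnegative reals, so that a divergent
  integral is \<open>\<infinity>\<close> (and not \<open>0\<close>, as it would be for the Bochner integral).\<close>

definition dirichlet_area :: "real \<Rightarrow> (complex \<Rightarrow> complex) \<Rightarrow> ennreal" where
  "dirichlet_area r g = (\<integral>\<^sup>+ z \<in> ball 0 r. ennreal ((norm (deriv g z))\<^sup>2) \<partial>lborel)"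

definition hyp2F1 :: "real \<Rightarrow> real \<Rightarrow> real \<Rightarrow> real \<Rightarrow> real" where
  "hyp2F1 a b c x = eval_fps (fps_hypergeo [a, b] [c] 1) x"

lemma hyp2F1_series:
  "hyp2F1 a b c x =
     (\<Sum>n. pochhammer a n * pochhammer b n / (pochhammer c n * pochhammer 1 n) * x ^ n)"
  by (simp add: hyp2F1_def eval_fps_def flip: pochhammer_fact)

text \<open>For \<open>z\<close> in the unit disc and \<open>0 < \<alpha> \<le> 1\<close>, \<open>1 - \<alpha> z\<close> has positive real part, so the
  principal power is analytic there and equals 1 at the origin.\<close>

definition k_fun :: "real \<Rightarrow> real \<Rightarrow> complex \<Rightarrow> complex" where
  "k_fun \<alpha> \<beta> z = z * (1 - of_real \<alpha> * z) powr of_real (- 2 * (1 - \<beta>))"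

text \<open>Functions on the unit disc are represented by total functions, so they are
  compared on the unit disc only.\<close>

definition rotation_of :: "(complex \<Rightarrow> complex) \<Rightarrow> (complex \<Rightarrow> complex) \<Rightarrow> bool" where
  "rotation_of k f \<longleftrightarrow>
     (\<exists>\<theta>::real. \<forall>z\<in>unit_disc. f z = exp (- \<i> * of_real \<theta>) * k (exp (\<i> * of_real \<theta>) * z))"

definition is_maximum :: "'a::order \<Rightarrow> 'a set \<Rightarrow> bool" where
  "is_maximum m X \<longleftrightarrow> m \<in> X \<and> (\<forall>x\<in>X. x \<le> m)"

end

theory Submission
  imports Defs
begin

text \<open>Put \<open>g = z / f = \<Sum> b\<^sub>n z\<^sup>n\<close> and \<open>A = 2 (1 - \<beta>)\<close>. The condition on \<open>f\<close> says
  \<open>z g' = \<alpha> w (z g' - A g)\<close> for a Schwarz function \<open>w\<close>, and Clunie's method gives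
  \<open>\<Sum>\<^bsub>n \<le> N\<^esub> n\<^sup>2 |b\<^sub>n|\<^sup>2 \<le> \<alpha>\<^sup>2 \<Sum>\<^bsub>n < N\<^esub> (n - A)\<^sup>2 |b\<^sub>n|\<^sup>2\<close> for every \<open>N\<close>, with equality for
  \<open>g = (1 - \<alpha> z)\<^sup>A\<close>. The area is \<open>\<pi> \<Sum> n |b\<^sub>n|\<^sup>2 \<rho>\<^bsup>2n\<^esup>\<close>; each of its partial sums is bounded by
  a combination of these inequalities with nonnegative multipliers, so it is largest for
  the extremal sequence. The multiplier of the inequality \<open>N = 1\<close> stays away from 0, hence equality of the
  areas forces \<open>|b\<^sub>1| = \<alpha> A\<close>, i.e. \<open>|w'(0)| = 1\<close>, and the Schwarz lemma makes \<open>w\<close> a rotation.\<close>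

section \<open>Comparison of weighted sums\<close>

locale weighted_recursion =
  fixes \<alpha> A \<rho> :: real
  assumes \<alpha>: "0 < \<alpha>" "\<alpha> \<le> 1" and A: "0 < A" "A \<le> 2" and \<rho>: "0 < \<rho>" "\<rho> \<le> 1"
begin

text \<open>For \<open>m \<ge> 1\<close>, the factor by which \<open>(real n)\<^sup>2 * y n\<close>
  changes from \<open>n = m\<close> to \<open>n = m + 1\<close> along the extremal sequence
  \<open>y\<close>.\<close>

definition ratio :: "nat \<Rightarrow> real" where
  "ratio m = \<alpha>\<^sup>2 * (1 - A / m)\<^sup>2"

text \<open>With its last left-hand term isolated, Clunie's inequality for \<open>N = m\<close>
  reads \<open>(real m)\<^sup>2 * x m \<le> excess x m\<close>.\<close>

definition excess :: "(nat \<Rightarrow> real) \<Rightarrow> nat \<Rightarrow> real" where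
  "excess x m = (\<Sum>n<m. \<alpha>\<^sup>2 * (real n - A)\<^sup>2 * x n) - (\<Sum>n<m. (real n)\<^sup>2 * x n)"

text \<open>Dual variables: the weighted sum of \<open>x\<close> over \<open>m, \<dots>, m + d - 1\<close> equals
  \<open>multiplier d m * excess x m\<close> minus a combination of the defects \<open>excess x k - k\<^sup>2 x k\<close>
  with coefficients \<open>multiplier (Suc e) k - multiplier e (Suc k)\<close>, where \<open>e = m + d - 1 - k\<close>.\<close>

fun multiplier :: "nat \<Rightarrow> nat \<Rightarrow> real" where
  "multiplier 0 m = 0"
| "multiplier (Suc d) m = \<rho> ^ (2 * m) / m + ratio m * multiplier d (Suc m)"

text \<open>Made for \<open>multiplier_diff\<close>: for \<open>m \<ge> 1\<close> the coefficient of
  the defect at \<open>m\<close> is nonnegative iff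
  \<open>slack m * multiplier d (Suc m) \<le> \<rho> ^ (2 * m)\<close>.\<close>

definition slack :: "nat \<Rightarrow> real" where
  "slack m = m * (1 - ratio m)"

lemma ratio_nonneg: "0 \<le> ratio m"
  by (simp add: ratio_def)

lemma slack_eq: "m \<ge> 1 \<Longrightarrow> slack m = m * (1 - \<alpha>\<^sup>2) + \<alpha>\<^sup>2 * (2 * A - A\<^sup>2 / m)"
  by (simp add: slack_def ratio_def power2_eq_square field_simps)

lemma \<alpha>_sq: "0 < \<alpha>\<^sup>2" "\<alpha>\<^sup>2 \<le> 1"
  using \<alpha> by (auto simp: power_le_one)

text \<open>This monotonicity is what makes the coefficients of the defects nonnegative.\<close>

lemma slack_less: assumes "m \<ge> 1" shows "slack m < slack (Suc m)"
proof -
  have "A\<^sup>2 / Suc m < A\<^sup>2 / m"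
    using A assms by (intro divide_strict_left_mono) auto
  then have "\<alpha>\<^sup>2 * (2 * A - A\<^sup>2 / m) < \<alpha>\<^sup>2 * (2 * A - A\<^sup>2 / Suc m)"
    using \<alpha>_sq by (intro mult_strict_left_mono) auto
  moreover have "m * (1 - \<alpha>\<^sup>2) \<le> Suc m * (1 - \<alpha>\<^sup>2)"
    using \<alpha>_sq by (intro mult_right_mono) auto
  ultimately show ?thesis
    using assms slack_eq[of m] slack_eq[of "Suc m"] by linarith
qed

text \<open>By monotonicity only index 1 matters, and \<open>slack 1 = 1 - \<alpha>\<^sup>2 +
  \<alpha>\<^sup>2 * (A * (2 - A))\<close> is nonnegative because \<open>A \<le> 2\<close>.\<close>

lemma slack_nonneg: assumes "m \<ge> 1" shows "0 \<le> slack m"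
proof -
  have "slack 1 \<le> slack m"
    using assms
  proof (induction m rule: dec_induct)
    case (step n)
    then show ?case using slack_less[of n] by simp
  qed simp
  moreover have "0 \<le> A * (2 - A)" using A by simp
  then have "0 \<le> \<alpha>\<^sup>2 * (2 * A - A\<^sup>2)"
    by (intro mult_nonneg_nonneg) (auto simp: power2_eq_square algebra_simps)
  then have "0 \<le> slack 1" using \<alpha>_sq slack_eq[of 1] by simp
  ultimately show ?thesis by simp
qed

lemma ratio_le_1: "m \<ge> 1 \<Longrightarrow> ratio m \<le> 1"
  using slack_nonneg[of m] by (simp add: slack_def zero_le_mult_iff)

lemma multiplier_nonneg: "0 \<le> multiplier d m"
  using \<rho> by (induction d arbitrary: m) (auto intro!: add_nonneg_nonneg mult_nonneg_nonneg simp: ratio_nonneg)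

text \<open>Unfolding \<open>multiplier\<close> once gives the combination of
  \<open>\<rho> ^ (2 * m)\<close> and \<open>slack m * multiplier d (Suc m)\<close> with weights
  \<open>1 - ratio m\<close> and \<open>ratio m\<close>; the induction hypothesis at
  \<open>Suc m\<close> bounds the latter once \<open>slack m\<close> is raised to
  \<open>slack (Suc m)\<close>.\<close>

lemma slack_multiplier_le: "m \<ge> 1 \<Longrightarrow> slack m * multiplier d m \<le> \<rho> ^ (2 * m)"
proof (induction d arbitrary: m)
  case 0 then show ?case using \<rho> by simp
next
  case (Suc d)
  have *: "slack m * multiplier d (Suc m) \<le> \<rho> ^ (2 * m)"
  proof -
    have "slack m * multiplier d (Suc m) \<le> slack (Suc m) * multiplier d (Suc m)"
      using slack_less[OF Suc.prems] multiplier_nonneg by (intro mult_right_mono) auto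
    also have "\<dots> \<le> \<rho> ^ (2 * Suc m)" using Suc.IH[of "Suc m"] by simp
    also have "\<dots> \<le> \<rho> ^ (2 * m)" using \<rho> by (intro power_decreasing) auto
    finally show ?thesis .
  qed
  have "slack m * multiplier (Suc d) m
      = (1 - ratio m) * \<rho> ^ (2 * m) + ratio m * (slack m * multiplier d (Suc m))"
    using Suc.prems by (simp add: slack_def field_simps)
  also have "\<dots> \<le> (1 - ratio m) * \<rho> ^ (2 * m) + ratio m * \<rho> ^ (2 * m)"
    using * ratio_nonneg by (intro add_left_mono mult_left_mono) auto
  finally show ?case by (simp add: algebra_simps)
qed

lemma multiplier_diff:
  "m \<ge> 1 \<Longrightarrow> m * (multiplier (Suc d) m - multiplier d (Suc m))
     = \<rho> ^ (2 * m) - slack m * multiplier d (Suc m)"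
  by (simp add: slack_def field_simps)

text \<open>Dual feasibility: the coefficients of the defects are nonnegative, by
  \<open>multiplier_diff\<close> and the preceding bound at \<open>Suc m\<close>.\<close>

lemma multiplier_mono:
  assumes "m \<ge> 1" shows "multiplier d (Suc m) \<le> multiplier (Suc d) m"
proof -
  have "slack m * multiplier d (Suc m) \<le> slack (Suc m) * multiplier d (Suc m)"
    using slack_less[OF assms] multiplier_nonneg by (intro mult_right_mono) auto
  also have "\<dots> \<le> \<rho> ^ (2 * Suc m)" using slack_multiplier_le[of "Suc m"] by simp
  also have "\<dots> \<le> \<rho> ^ (2 * m)" using \<rho> by (intro power_decreasing) auto
  finally have "0 \<le> m * (multiplier (Suc d) m - multiplier d (Suc m))"
    using multiplier_diff[OF assms] by simp
  then show ?thesis using assms by (simp add: zero_le_mult_iff)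
qed

text \<open>The recursion for \<open>multiplier\<close> is designed for this identity: it makes the
  coefficients of \<open>x m\<close> on both sides agree.\<close>

lemma weighted_sum_step:
  assumes "m \<ge> 1"
  shows "m * \<rho> ^ (2 * m) * x m + multiplier d (Suc m) * excess x (Suc m)
    = multiplier (Suc d) m * excess x m
      - (excess x m - (real m)\<^sup>2 * x m) * (multiplier (Suc d) m - multiplier d (Suc m))"
proof -
  have e: "excess x (Suc m) = excess x m - (real m)\<^sup>2 * x m + \<alpha>\<^sup>2 * (real m - A)\<^sup>2 * x m"
    by (simp add: excess_def)
  have r: "(real m)\<^sup>2 * ratio m = \<alpha>\<^sup>2 * (real m - A)\<^sup>2"
    using assms by (simp add: ratio_def field_simps power2_eq_square)
  have "(real m)\<^sup>2 * multiplier (Suc d) m = m * \<rho> ^ (2 * m) + \<alpha>\<^sup>2 * (real m - A)\<^sup>2 * multiplier d (Suc m)"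
    unfolding r[symmetric] using assms by (simp add: field_simps power2_eq_square)
  then show ?thesis unfolding e by (simp only: algebra_simps)
qed

lemma sum_Suc_left: "(\<Sum>n=m..<m + Suc d. f n) = f m + (\<Sum>n=Suc m..<Suc m + d. f n)" for f :: "nat \<Rightarrow> real"
  by (subst sum.atLeast_Suc_lessThan) auto

lemma sum_Suc_shift: "(\<Sum>n<d. f (Suc n)) = (\<Sum>n=1..<1 + d. f n)" for f :: "nat \<Rightarrow> real"
  by (induction d) auto

text \<open>Iterates the step, dropping a nonnegative defect each time. For \<open>m = 1\<close> the
  bound depends on \<open>x\<close> only through \<open>x 0\<close>, so it is the same for all
  normalized competitors.\<close>

lemma weighted_sum_le:
  assumes "\<And>m. m \<ge> 1 \<Longrightarrow> (real m)\<^sup>2 * x m \<le> excess x m" "m \<ge> 1"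
  shows "(\<Sum>n=m..<m + d. n * \<rho> ^ (2 * n) * x n) \<le> multiplier d m * excess x m"
  using assms(2)
proof (induction d arbitrary: m)
  case (Suc d)
  have "(\<Sum>n=m..<m + Suc d. n * \<rho> ^ (2 * n) * x n)
      \<le> m * \<rho> ^ (2 * m) * x m + multiplier d (Suc m) * excess x (Suc m)"
    using Suc.IH[of "Suc m"] unfolding sum_Suc_left by simp
  also have "\<dots> \<le> multiplier (Suc d) m * excess x m"
    unfolding weighted_sum_step[OF Suc.prems]
    using assms(1)[OF Suc.prems] multiplier_mono[OF Suc.prems, of d] by simp
  finally show ?case .
qed auto

text \<open>When every defect is zero the iteration loses nothing, so the bound is attained.\<close>

lemma weighted_sum_eq:
  assumes "\<And>m. m \<ge> 1 \<Longrightarrow> (real m)\<^sup>2 * x m = excess x m" "m \<ge> 1"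
  shows "(\<Sum>n=m..<m + d. n * \<rho> ^ (2 * n) * x n) = multiplier d m * excess x m"
  using assms(2)
proof (induction d arbitrary: m)
  case (Suc d)
  show ?case using Suc.IH[of "Suc m"] weighted_sum_step[OF Suc.prems, of x d] assms(1)[OF Suc.prems]
    unfolding sum_Suc_left by simp
qed auto

lemma excess_1: "x 0 = 1 \<Longrightarrow> excess x 1 = \<alpha>\<^sup>2 * A\<^sup>2"
  by (simp add: excess_def)

lemma excess_of_recursion:
  assumes "\<And>n. (real (Suc n))\<^sup>2 * y (Suc n) = \<alpha>\<^sup>2 * (real n - A)\<^sup>2 * y n" "m \<ge> 1"
  shows "(real m)\<^sup>2 * y m = excess y m"
  using assms(2)
proof (induction m rule: dec_induct)
  case base show ?case using assms(1)[of 0] by (simp add: excess_def)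
next
  case (step n) then show ?case using assms(1)[of n] by (simp add: excess_def)
qed

text \<open>A bound on the first dual slack that is uniform in the number of summands, so that the
  strictness at index 1 survives the passage to the infinite sum.\<close>

definition gap :: real where "gap = \<rho>\<^sup>2 * (1 - slack 1 / slack 2)"

text \<open>By \<open>multiplier_diff\<close> the difference is
  \<open>\<rho>\<^sup>2 - slack 1 * multiplier d 2\<close>, where
  \<open>multiplier d 2 \<le> \<rho>\<^sup>2 / slack 2\<close> for every \<open>d\<close>;
  positivity is the strict inequality \<open>slack 1 < slack 2\<close>.\<close>

lemma gap_pos: "0 < gap" and gap_le: "gap \<le> multiplier (Suc d) 1 - multiplier d 2"
proof -
  have s: "0 \<le> slack 1" "slack 1 < slack 2"
    using slack_nonneg[of 1] slack_less[of 1] by (auto simp: numeral_2_eq_2)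
  then show "0 < gap" using \<rho> by (simp add: gap_def)
  have "slack 2 * multiplier d 2 \<le> \<rho> ^ (2 * 2)" by (rule slack_multiplier_le) simp
  also have "\<dots> \<le> \<rho> ^ 2" using \<rho> by (intro power_decreasing) auto
  finally have "multiplier d 2 \<le> \<rho>\<^sup>2 / slack 2" using s by (simp add: field_simps)
  then have "slack 1 * multiplier d 2 \<le> slack 1 * (\<rho>\<^sup>2 / slack 2)"
    using s by (intro mult_left_mono) auto
  then show "gap \<le> multiplier (Suc d) 1 - multiplier d 2"
    using multiplier_diff[of 1 d] by (simp add: gap_def algebra_simps numeral_2_eq_2)
qed

text \<open>The first step is taken exactly in order to keep its defect
  \<open>excess x 1 - x 1 = y 1 - x 1\<close>, which carries weight at least \<open>gap\<close>;
  later defects are dropped. An empty sum has no first step, hence the case distinction.\<close>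

lemma weighted_partial_sum_le:
  assumes x: "\<And>m. m \<ge> 1 \<Longrightarrow> (real m)\<^sup>2 * x m \<le> excess x m" "x 0 = 1"
    and y: "\<And>n. (real (Suc n))\<^sup>2 * y (Suc n) = \<alpha>\<^sup>2 * (real n - A)\<^sup>2 * y n" "y 0 = 1"
  shows "(\<Sum>n<d. Suc n * \<rho> ^ (2 * Suc n) * x (Suc n))
     \<le> (\<Sum>n<d. Suc n * \<rho> ^ (2 * Suc n) * y (Suc n)) - (if d = 0 then 0 else gap * (y 1 - x 1))"
proof (cases d)
  case (Suc e)
  have y': "(real m)\<^sup>2 * y m = excess y m" if "m \<ge> 1" for m
    using excess_of_recursion[OF y(1) that] .
  have "(\<Sum>n=1..<1+Suc e. n * \<rho> ^ (2 * n) * x n)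
     \<le> multiplier (Suc e) 1 * excess x 1 - (excess x 1 - x 1) * (multiplier (Suc e) 1 - multiplier e 2)"
    using weighted_sum_step[of 1 x e] weighted_sum_le[OF x(1), of "Suc 1" e] unfolding sum_Suc_left
    by (simp add: numeral_2_eq_2)
  also have "\<dots> \<le> multiplier (Suc e) 1 * excess x 1 - (excess x 1 - x 1) * gap"
    using gap_le[of e] x(1)[of 1] by (intro diff_left_mono mult_left_mono) auto
  also have "multiplier (Suc e) 1 * excess x 1 = (\<Sum>n=1..<1+Suc e. n * \<rho> ^ (2 * n) * y n)"
    using weighted_sum_eq[OF y', of 1 "Suc e"] excess_1[of x] excess_1[of y] x(2) y(2) by simp
  also have "excess x 1 = y 1"
    using excess_1[of x] x(2) y(1)[of 0] y(2) by simp
  finally show ?thesis unfolding sum_Suc_shift[of "\<lambda>n. n * \<rho> ^ (2 * n) * x n"] sum_Suc_shift[of "\<lambda>n. n * \<rho> ^ (2 * n) * y n"]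
    using Suc by (simp add: mult.commute)
qed auto

text \<open>The partial sums equal \<open>multiplier d 1 * excess y 1\<close> and the multipliers
  are bounded in \<open>d\<close>. This covers \<alpha> = \<rho> = 1, where no geometric decay is
  available.\<close>

lemma summable_weighted_extremal:
  assumes y: "\<And>n. (real (Suc n))\<^sup>2 * y (Suc n) = \<alpha>\<^sup>2 * (real n - A)\<^sup>2 * y n" "y 0 = 1"
  shows "summable (\<lambda>n. Suc n * \<rho> ^ (2 * Suc n) * y (Suc n))"
proof (rule summableI_nonneg_bounded)
  have y0: "y n \<ge> 0" for n
  proof (induction n)
    case (Suc n)
    have "(real (Suc n))\<^sup>2 * y (Suc n) \<ge> 0" unfolding y(1) using Suc by simp
    then show ?case by (simp add: zero_le_mult_iff del: of_nat_Suc)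
  qed (simp add: y)
  then show "0 \<le> Suc n * \<rho> ^ (2 * Suc n) * y (Suc n)" for n
    using \<rho> by (auto intro!: mult_nonneg_nonneg)
  \<comment> \<open>The bound divides by \<open>slack\<close> at index 2 since
    \<open>slack 1\<close> vanishes when \<alpha> = 1 and \<open>A = 2\<close>.\<close>
  have s: "0 < slack 2"
    using slack_nonneg[of 1] slack_less[of 1] by (auto simp: numeral_2_eq_2)
  have m: "multiplier d 1 \<le> \<rho>\<^sup>2 + \<rho> ^ 4 / slack 2" for d
  proof (cases d)
    case (Suc e)
    have "slack 2 * multiplier e 2 \<le> \<rho> ^ 4" using slack_multiplier_le[of 2 e] by simp
    then have "multiplier e 2 \<le> \<rho> ^ 4 / slack 2" using s by (simp add: field_simps)
    moreover have "ratio 1 * multiplier e 2 \<le> 1 * multiplier e 2"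
      using ratio_le_1[of 1] multiplier_nonneg by (intro mult_right_mono) auto
    ultimately show ?thesis using Suc by (simp add: numeral_2_eq_2)
  qed (use s \<rho> in simp)
  show "(\<Sum>n<d. Suc n * \<rho> ^ (2 * Suc n) * y (Suc n)) \<le> (\<rho>\<^sup>2 + \<rho> ^ 4 / slack 2) * (\<alpha>\<^sup>2 * A\<^sup>2)" for d
    using weighted_sum_eq[OF excess_of_recursion[OF y(1)], of 1 d] m[of d] excess_1[of y, OF y(2)]
    unfolding sum_Suc_shift[of "\<lambda>n. n * \<rho> ^ (2 * n) * y n" d]
    by (simp add: mult_right_mono)
qed

end

section \<open>Integrals over discs in the complex plane\<close>

lemma nn_integral_lborel_translate:
  fixes u :: "complex \<Rightarrow> ennreal"
  assumes [measurable]: "u \<in> borel_measurable borel"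
  shows "(\<integral>\<^sup>+x. u (x + a) \<partial>lborel) = (\<integral>\<^sup>+x. u x \<partial>lborel)"
proof -
  have "(\<integral>\<^sup>+x. u x \<partial>lborel) = (\<integral>\<^sup>+x. u x \<partial>distr lborel borel ((+) a))"
    by (simp add: lborel_distr_plus)
  also have "\<dots> = (\<integral>\<^sup>+x. u (a + x) \<partial>lborel)"
    by (subst nn_integral_distr) auto
  finally show ?thesis by (simp add: add.commute)
qed

lemma nn_integral_lborel_reflect:
  fixes u :: "complex \<Rightarrow> ennreal"
  assumes [measurable]: "u \<in> borel_measurable borel"
  shows "(\<integral>\<^sup>+x. u (a - x) \<partial>lborel) = (\<integral>\<^sup>+x. u x \<partial>lborel)"
proof -
  have "lborel = density (distr lborel borel (\<lambda>x::complex. a + (-1) *\<^sub>R x)) (\<lambda>_. \<bar>-1::real\<bar> ^ DIM(complex))"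
    by (rule lborel_affine) simp
  then have "(\<integral>\<^sup>+x. u x \<partial>lborel) = (\<integral>\<^sup>+x. u x \<partial>distr lborel borel (\<lambda>x::complex. a - x))"
    by (simp add: one_ennreal_def[symmetric] density_1)
  also have "\<dots> = (\<integral>\<^sup>+x. u (a - x) \<partial>lborel)"
    by (subst nn_integral_distr) auto
  finally show ?thesis by simp
qed

text \<open>Uniqueness of Haar measure by the convolution trick: \<open>\<integral>\<integral> 1\<^sub>S (c x) 1\<^sub>B (c x - y) dx dy\<close>,
  with \<open>B\<close> the rotation-invariant unit disc, is evaluated in both orders.\<close>

lemma lborel_distr_rotation:
  fixes c :: complex
  assumes c: "norm c = 1"
  shows "distr lborel borel ((*) c) = lborel"
proof (rule measure_eqI)
  fix S assume "S \<in> sets (distr lborel borel ((*) c))"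
  then have S [measurable]: "S \<in> sets borel" by simp
  define B :: "complex set" where "B = ball 0 1"
  have B [measurable]: "B \<in> sets borel" by (simp add: B_def)
  have c0: "c \<noteq> 0" using c by auto
  let ?i = "indicator :: complex set \<Rightarrow> complex \<Rightarrow> ennreal"
  have "emeasure (distr lborel borel ((*) c)) S * emeasure lborel B
      = (\<integral>\<^sup>+x. ?i S (c * x) * (\<integral>\<^sup>+y. ?i B y \<partial>lborel) \<partial>lborel)"
  proof -
    have "emeasure (distr lborel borel ((*) c)) S = (\<integral>\<^sup>+x. ?i S x \<partial>distr lborel borel ((*) c))"
      by simp
    also have "\<dots> = (\<integral>\<^sup>+x. ?i S (c * x) \<partial>lborel)" by (subst nn_integral_distr) auto
    finally show ?thesis by (simp add: nn_integral_multc)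
  qed
  also have "\<dots> = (\<integral>\<^sup>+x. (\<integral>\<^sup>+y. ?i S (c * x) * ?i B (c * x - y) \<partial>lborel) \<partial>lborel)"
    by (subst nn_integral_cmult) (auto simp: nn_integral_lborel_reflect)
  also have "\<dots> = (\<integral>\<^sup>+y. (\<integral>\<^sup>+x. ?i S (c * x) * ?i B (c * x - y) \<partial>lborel) \<partial>lborel)"
    by (rule lborel_pair.Fubini') measurable
  also have "\<dots> = (\<integral>\<^sup>+y. (\<integral>\<^sup>+x. ?i S (c * x + y) * ?i B (c * x) \<partial>lborel) \<partial>lborel)"
  proof (rule nn_integral_cong)
    fix y
    \<comment> \<open>Shifting \<open>x\<close> by \<open>y / c\<close> moves the translation from
      \<open>B\<close> to \<open>S\<close>.\<close>
    have "(\<integral>\<^sup>+x. ?i S (c * x) * ?i B (c * x - y) \<partial>lborel)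
        = (\<integral>\<^sup>+x. ?i S (c * (x + y / c)) * ?i B (c * (x + y / c) - y) \<partial>lborel)"
      by (rule nn_integral_lborel_translate[symmetric]) measurable
    then show "(\<integral>\<^sup>+x. ?i S (c * x) * ?i B (c * x - y) \<partial>lborel)
        = (\<integral>\<^sup>+x. ?i S (c * x + y) * ?i B (c * x) \<partial>lborel)"
      using c0 by (simp add: distrib_left)
  qed
  also have "\<dots> = (\<integral>\<^sup>+x. (\<integral>\<^sup>+y. ?i S (c * x + y) * ?i B (c * x) \<partial>lborel) \<partial>lborel)"
    by (rule lborel_pair.Fubini') measurable
  also have "\<dots> = (\<integral>\<^sup>+x. emeasure lborel S * ?i B x \<partial>lborel)"
  proof (rule nn_integral_cong)
    fix x
    have "?i B (c * x) = ?i B x" using c by (simp add: B_def indicator_def norm_mult)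
    then show "(\<integral>\<^sup>+y. ?i S (c * x + y) * ?i B (c * x) \<partial>lborel) = emeasure lborel S * ?i B x"
      using nn_integral_lborel_translate[of "?i S" "c * x"] by (simp add: nn_integral_multc add.commute)
  qed
  also have "\<dots> = emeasure lborel S * emeasure lborel B"
    by (subst nn_integral_cmult) auto
  finally have "emeasure lborel B * emeasure (distr lborel borel ((*) c)) S = emeasure lborel B * emeasure lborel S"
    by (simp only: mult.commute)
  \<comment> \<open>The common factor is finite and nonzero, so it may be cancelled.\<close>
  moreover have "emeasure lborel B = ennreal pi"
    by (simp add: B_def emeasure_ball unit_ball_vol_2)
  ultimately show "emeasure (distr lborel borel ((*) c)) S = emeasure lborel S"
    by (simp add: ennreal_mult_cancel_left)
qed simp

lemma nn_integral_lborel_rotation: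
  fixes u :: "complex \<Rightarrow> ennreal"
  assumes [measurable]: "u \<in> borel_measurable borel" and c: "norm c = 1"
  shows "(\<integral>\<^sup>+z. u (c * z) \<partial>lborel) = (\<integral>\<^sup>+z. u z \<partial>lborel)"
proof -
  have "(\<integral>\<^sup>+z. u z \<partial>lborel) = (\<integral>\<^sup>+z. u z \<partial>distr lborel borel ((*) c))"
    by (simp only: lborel_distr_rotation[OF c])
  also have "\<dots> = (\<integral>\<^sup>+z. u (c * z) \<partial>lborel)" by (subst nn_integral_distr) auto
  finally show ?thesis by simp
qed

text \<open>Layer-cake formula for \<open>t = |z|\<^sup>2\<close>; only the area of discs enters.\<close>

lemma nn_integral_ball_norm_power:
  assumes r: "0 < r"
  shows "(\<integral>\<^sup>+z\<in>ball 0 r. ennreal (norm (z::complex) ^ (2 * n)) \<partial>lborel)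
    = ennreal (pi * r ^ (2 * Suc n) / Suc n)"
proof (cases "n = 0")
  case True
  then show ?thesis using r by (simp add: emeasure_ball unit_ball_vol_2 eval_nat_numeral mult.commute)
next
  case False
  then have n: "n > 0" by simp
  \<comment> \<open>The derivative of \<open>t ^ n\<close>, so that \<open>norm z ^ (2 * n)\<close>
    is its integral over \<open>{0..(norm z)\<^sup>2}\<close>; for \<open>n = 0\<close> the
    derivative vanishes and this fails.\<close>
  define d where "d t = n * t ^ (n - 1)" for t :: real
  have d0: "d t \<ge> 0" if "t \<ge> 0" for t using that by (simp add: d_def)
  have dm [measurable]: "d \<in> borel_measurable borel" unfolding d_def by measurable
  have pow: "(\<integral>\<^sup>+t. ennreal (d t) * indicator {0..a} t \<partial>lborel) = ennreal (a ^ n)" if "a \<ge> 0" for a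
  proof -
    have "((\<lambda>t. t ^ n) has_real_derivative d t) (at t)" for t
      unfolding d_def by (auto intro!: derivative_eq_intros)
    then show ?thesis
      using that n by (subst nn_integral_FTC_Icc[where F = "\<lambda>t. t ^ n"]) (auto simp: d0 has_real_derivative_iff_has_vector_derivative[symmetric] intro: DERIV_subset)
  qed
  have "(\<integral>\<^sup>+z\<in>ball 0 r. ennreal (norm (z::complex) ^ (2 * n)) \<partial>lborel)
     = (\<integral>\<^sup>+z. (\<integral>\<^sup>+t. ennreal (d t) * indicator {0..(norm (z::complex))\<^sup>2} t * indicator (ball 0 r) z \<partial>lborel) \<partial>lborel)"
    by (intro nn_integral_cong) (simp add: nn_integral_multc pow power_mult)
  also have "\<dots> = (\<integral>\<^sup>+t. (\<integral>\<^sup>+z. ennreal (d t) * indicator {0..(norm (z::complex))\<^sup>2} t * indicator (ball 0 r) z \<partial>lborel) \<partial>lborel)"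
    by (rule lborel_pair.Fubini'[symmetric]) (simp add: indicator_def, measurable)
  also have "\<dots> = (\<integral>\<^sup>+t. ennreal (pi * (r\<^sup>2 - t) * d t) * indicator {0..r\<^sup>2} t \<partial>lborel)"
  proof (rule nn_integral_cong)
    fix t :: real
    show "(\<integral>\<^sup>+z. ennreal (d t) * indicator {0..(norm (z::complex))\<^sup>2} t * indicator (ball 0 r) z \<partial>lborel)
      = ennreal (pi * (r\<^sup>2 - t) * d t) * indicator {0..r\<^sup>2} t"
    proof (cases "0 \<le> t \<and> t \<le> r\<^sup>2")
      case True
      have "sqrt t \<le> norm z \<longleftrightarrow> t \<le> (norm z)\<^sup>2" for z :: complex
        using real_sqrt_le_iff[of t "(norm z)\<^sup>2"] by simp
      \<comment> \<open>For fixed \<open>t\<close> the points counted form the annulus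
        \<open>sqrt t \<le> norm z < r\<close>, of area \<open>pi * (r\<^sup>2 - t)\<close>.\<close>
      then have i: "indicator {0..(norm z)\<^sup>2} t * indicator (ball 0 r) z
          = (indicator (ball 0 r - ball 0 (sqrt t)) z :: ennreal)" for z :: complex
        using True by (auto simp: indicator_def not_less)
      have st: "sqrt t \<le> r" using True r by (intro real_le_lsqrt) auto
      have "emeasure lborel (ball 0 r - ball 0 (sqrt t) :: complex set)
          = emeasure lborel (ball 0 r :: complex set) - emeasure lborel (ball 0 (sqrt t) :: complex set)"
        using st by (intro emeasure_Diff) (auto simp: emeasure_ball True)
      also have "\<dots> = ennreal (pi * (r\<^sup>2 - t))"
        using True r by (simp add: emeasure_ball unit_ball_vol_2 ennreal_minus algebra_simps)
      finally have "emeasure lborel (ball 0 r - ball 0 (sqrt t) :: complex set) = ennreal (pi * (r\<^sup>2 - t))" .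
      moreover have "(\<integral>\<^sup>+z. ennreal (d t) * indicator {0..(norm (z::complex))\<^sup>2} t * indicator (ball 0 r) z \<partial>lborel)
          = ennreal (d t) * emeasure lborel (ball 0 r - ball 0 (sqrt t) :: complex set)"
        by (simp only: mult.assoc i) (rule nn_integral_cmult_indicator, simp)
      ultimately show ?thesis
        using True d0[of t] by (simp add: ennreal_mult[symmetric] mult.commute mult.left_commute)
    next
      case False
      have "indicator {0..(norm z)\<^sup>2} t * indicator (ball 0 r) z = (0::ennreal)" for z :: complex
        using False r by (auto simp: indicator_def dest: power_strict_mono[of _ r 2])
      then have "(\<integral>\<^sup>+z. ennreal (d t) * indicator {0..(norm (z::complex))\<^sup>2} t * indicator (ball 0 r) z \<partial>lborel) = 0"
        by (simp only: mult.assoc) simp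
      then show ?thesis using False by auto
    qed
  qed
  also have "\<dots> = ennreal (pi * (r\<^sup>2 * (r\<^sup>2) ^ n - n * (r\<^sup>2) ^ Suc n / Suc n))"
  proof -
    define F where "F t = pi * (r\<^sup>2 * t ^ n - n * t ^ Suc n / Suc n)" for t :: real
    have "(F has_real_derivative pi * (r\<^sup>2 - t) * d t) (at t)" for t
    proof -
      have "(F has_real_derivative pi * (r\<^sup>2 * (n * t ^ (n - 1)) - n * (Suc n * t ^ n) / Suc n)) (at t)"
        using DERIV_pow[of n t] DERIV_pow[of "Suc n" t] unfolding F_def
        by (intro DERIV_cmult DERIV_diff DERIV_cdivide) (simp_all del: of_nat_Suc power_Suc)
      moreover have "t ^ n = t * t ^ (n - 1)" using n by (cases n) auto
      then have "pi * (r\<^sup>2 * (n * t ^ (n - 1)) - n * t ^ n) = pi * (r\<^sup>2 - t) * d t"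
        by (simp add: d_def algebra_simps)
      then have "pi * (r\<^sup>2 * (n * t ^ (n - 1)) - n * (Suc n * t ^ n) / Suc n) = pi * (r\<^sup>2 - t) * d t"
        by (simp del: of_nat_Suc)
      ultimately show ?thesis by (simp add: mult.assoc)
    qed
    then show ?thesis
      using n by (subst nn_integral_FTC_Icc[where F = F])
        (auto simp: d0 F_def power_0_left has_real_derivative_iff_has_vector_derivative[symmetric] intro: DERIV_subset)
  qed
  also have "pi * (r\<^sup>2 * (r\<^sup>2) ^ n - n * (r\<^sup>2) ^ Suc n / Suc n) = pi * r ^ (2 * Suc n) / Suc n"
    by (simp add: field_simps power2_eq_square power_mult)
  finally show ?thesis .
qed

section \<open>Parseval's identity, from trigonometric polynomials to power series on
  circles\<close>

lemma has_integral_cis: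
  fixes k :: int
  shows "((\<lambda>t. cis (k * t)) has_integral (if k = 0 then 2 * pi else 0)) {0..2 * pi}"
proof (cases "k = 0")
  case True
  then show ?thesis using has_integral_const_real[of "1::complex" 0 "2 * pi"]
    by (simp add: scaleR_conv_of_real)
next
  case False
  have "((\<lambda>z. exp (\<i> * (of_int k * z)) / (\<i> * k)) has_field_derivative exp (\<i> * (of_int k * z))) (at z)" for z
    using False by (auto intro!: derivative_eq_intros simp: field_simps)
  from has_vector_derivative_real_field[OF this]
  have "((\<lambda>t. cis (k * t) / (\<i> * k)) has_vector_derivative cis (k * t)) (at t within {0..2 * pi})" for t :: real
    by (simp add: cis_conv_exp)
  then have "((\<lambda>t. cis (k * t)) has_integral cis (k * (2 * pi)) / (\<i> * k) - cis (k * (0::real)) / (\<i> * k)) {0..2 * pi}"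
    by (intro fundamental_theorem_of_calculus) auto
  moreover have "cis (k * (2 * pi)) = 1"
    using cis_multiple_2pi[of "of_int k"] by (simp add: mult.commute mult.left_commute)
  ultimately show ?thesis using False by simp
qed

lemma parseval_trig_polynomial:
  fixes c :: "nat \<Rightarrow> complex"
  shows "((\<lambda>t. (norm (\<Sum>n<N. c n * cis (n * t)))\<^sup>2) has_integral 2 * pi * (\<Sum>n<N. (norm (c n))\<^sup>2)) {0..2 * pi}"
proof -
  have eq: "complex_of_real ((norm (\<Sum>n<N. c n * cis (n * t)))\<^sup>2)
      = (\<Sum>n<N. \<Sum>m<N. c n * cnj (c m) * cis ((int n - int m) * t))" for t :: real
  proof -
    have "cis ((int n - int m) * t) = cis (n * t) * cnj (cis (m * t))" for n m
      by (simp add: cis_mult cis_cnj algebra_simps)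
    then show ?thesis
      unfolding complex_norm_square by (simp add: sum_product cnj_sum mult_ac)
  qed
  have "((\<lambda>t. \<Sum>n<N. \<Sum>m<N. c n * cnj (c m) * cis ((int n - int m) * t)) has_integral
      (\<Sum>n<N. \<Sum>m<N. c n * cnj (c m) * (if int n - int m = 0 then 2 * pi else 0))) {0..2 * pi}"
    by (intro has_integral_sum finite_lessThan has_integral_mult_right has_integral_cis)
  also have "(\<Sum>n<N. \<Sum>m<N. c n * cnj (c m) * (if int n - int m = 0 then 2 * pi else 0))
      = complex_of_real (2 * pi * (\<Sum>n<N. (norm (c n))\<^sup>2))"
    by (simp add: if_distrib[of of_real] if_distrib[of "(*) _"] sum_distrib_left complex_norm_square
          mult_ac del: of_real_power cong: if_cong)
  finally have "((\<lambda>t. complex_of_real ((norm (\<Sum>n<N. c n * cis (n * t)))\<^sup>2)) has_integral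
      complex_of_real (2 * pi * (\<Sum>n<N. (norm (c n))\<^sup>2))) {0..2 * pi}"
    unfolding eq .
  from has_integral_linear[OF this bounded_linear_Re] show ?thesis
    by (simp only: o_def Re_complex_of_real)
qed

text \<open>Dominated convergence from the polynomial case: absolute summability supplies a constant
  majorant for the partial sums.\<close>

lemma parseval_trig_series:
  fixes c :: "nat \<Rightarrow> complex"
  assumes c: "summable (\<lambda>n. norm (c n))"
  shows "summable (\<lambda>n. (norm (c n))\<^sup>2)"
    and "((\<lambda>t. (norm (\<Sum>n. c n * cis (n * t)))\<^sup>2) has_integral 2 * pi * (\<Sum>n. (norm (c n))\<^sup>2)) {0..2 * pi}"
proof -
  define f where "f N t = (norm (\<Sum>n<N. c n * cis (n * t)))\<^sup>2" for N :: nat and t :: real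
  define g where "g t = (norm (\<Sum>n. c n * cis (n * t)))\<^sup>2" for t :: real
  have f: "(f N has_integral 2 * pi * (\<Sum>n<N. (norm (c n))\<^sup>2)) {0..2 * pi}" for N
    unfolding f_def by (rule parseval_trig_polynomial)
  have bound: "norm (f N t) \<le> (\<Sum>n. norm (c n))\<^sup>2" for N t
  proof -
    have "norm (\<Sum>n<N. c n * cis (n * t)) \<le> (\<Sum>n<N. norm (c n))"
      by (rule order.trans[OF norm_sum]) (simp add: norm_mult)
    also have "\<dots> \<le> (\<Sum>n. norm (c n))" by (rule sum_le_suminf[OF c]) auto
    finally show ?thesis by (simp add: f_def power_mono)
  qed
  have lim: "(\<lambda>N. f N t) \<longlonglongrightarrow> g t" for t
  proof -
    have "summable (\<lambda>n. c n * cis (n * t))"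
      by (rule summable_norm_cancel) (simp add: norm_mult c)
    then show ?thesis unfolding f_def g_def
      by (intro tendsto_intros) (simp flip: sums_def add: summable_sums)
  qed
  have "g integrable_on {0..2 * pi}" "(\<lambda>N. integral {0..2 * pi} (f N)) \<longlonglongrightarrow> integral {0..2 * pi} g"
    using dominated_convergence[of f "{0..2 * pi}" "\<lambda>_. (\<Sum>n. norm (c n))\<^sup>2" g] f bound lim
    by (auto simp: has_integral_integrable)
  moreover have "integral {0..2 * pi} (f N) = 2 * pi * (\<Sum>n<N. (norm (c n))\<^sup>2)" for N
    using f by (rule integral_unique)
  ultimately have g: "(\<lambda>N. 2 * pi * (\<Sum>n<N. (norm (c n))\<^sup>2)) \<longlonglongrightarrow> integral {0..2 * pi} g" "g integrable_on {0..2 * pi}"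
    by simp_all
  from tendsto_mult_left[OF g(1), of "1 / (2 * pi)"]
  have *: "(\<lambda>n. (norm (c n))\<^sup>2) sums (integral {0..2 * pi} g / (2 * pi))"
    by (simp add: sums_def)
  then show "summable (\<lambda>n. (norm (c n))\<^sup>2)" by (rule sums_summable)
  have "integral {0..2 * pi} g = 2 * pi * (\<Sum>n. (norm (c n))\<^sup>2)"
    using sums_unique[OF *] by (simp add: field_simps)
  then show "(g has_integral 2 * pi * (\<Sum>n. (norm (c n))\<^sup>2)) {0..2 * pi}"
    using g(2) by (simp add: has_integral_integral)
qed

text \<open>Parseval's identity on the circle through \<open>z\<close>; convergence at a larger
  radius \<open>s < 1\<close> makes the series absolutely convergent on it.\<close>

lemma gutzmer:
  fixes c :: "nat \<Rightarrow> complex" and h :: "complex \<Rightarrow> complex"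
  assumes h: "\<And>w. norm w < 1 \<Longrightarrow> (\<lambda>n. c n * w ^ n) sums h w" and z: "norm z < 1"
  shows "summable (\<lambda>n. (norm (c n))\<^sup>2 * norm z ^ (2 * n))"
    and "((\<lambda>t. (norm (h (cis t * z)))\<^sup>2) has_integral 2 * pi * (\<Sum>n. (norm (c n))\<^sup>2 * norm z ^ (2 * n))) {0..2 * pi}"
proof -
  obtain s where s: "norm z < s" "s < 1" using dense z by blast
  have "summable (\<lambda>n. norm (c n * z ^ n))"
    using sums_summable[OF h, of "of_real s"] s norm_ge_zero[of z]
    by (intro powser_insidea[of c "of_real s"]) auto
  from parseval_trig_series[OF this]
  have *: "summable (\<lambda>n. (norm (c n * z ^ n))\<^sup>2)"
    "((\<lambda>t. (norm (\<Sum>n. c n * z ^ n * cis (n * t)))\<^sup>2) has_integral 2 * pi * (\<Sum>n. (norm (c n * z ^ n))\<^sup>2)) {0..2 * pi}"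
    by auto
  have "(norm (c n * z ^ n))\<^sup>2 = (norm (c n))\<^sup>2 * norm z ^ (2 * n)" for n
    by (simp add: norm_mult norm_power power_mult_distrib mult.commute flip: power_mult)
  moreover have "(\<Sum>n. c n * z ^ n * cis (n * t)) = h (cis t * z)" for t :: real
    using sums_unique[OF h[of "cis t * z"]] z
    by (simp add: norm_mult power_mult_distrib Complex.DeMoivre mult_ac)
  ultimately show "summable (\<lambda>n. (norm (c n))\<^sup>2 * norm z ^ (2 * n))"
    "((\<lambda>t. (norm (h (cis t * z)))\<^sup>2) has_integral 2 * pi * (\<Sum>n. (norm (c n))\<^sup>2 * norm z ^ (2 * n))) {0..2 * pi}"
    using * by simp_all
qed

text \<open>Averaging the rotated integrals over all angles replaces polar coordinates.\<close>

lemma nn_integral_ball_norm_square: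
  fixes c :: "nat \<Rightarrow> complex" and h :: "complex \<Rightarrow> complex"
  assumes h: "\<And>w. norm w < 1 \<Longrightarrow> (\<lambda>n. c n * w ^ n) sums h w" and r: "0 < r" "r \<le> 1"
  shows "(\<integral>\<^sup>+z\<in>ball 0 r. ennreal ((norm (h z))\<^sup>2) \<partial>lborel)
    = (\<Sum>n. ennreal (pi * (norm (c n))\<^sup>2 * r ^ (2 * Suc n) / Suc n))"
proof -
  define u where "u z = ennreal ((norm (h z))\<^sup>2) * indicator (ball 0 r) z" for z
  have "h holomorphic_on ball 0 1"
    by (rule power_series_holomorphic[where a = c]) (use h in simp)
  then have "continuous_on (ball 0 r) h"
    using r by (intro holomorphic_on_imp_continuous_on) (auto elim: holomorphic_on_subset)
  \<comment> \<open>Nothing is known about \<open>h\<close> off the unit disc, so measurability is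
    shown for its cut-off to the ball, where it is continuous.\<close>
  then have "(\<lambda>z. indicator (ball 0 r) z *\<^sub>R h z) \<in> borel_measurable borel"
    by (intro borel_measurable_continuous_on_indicator) auto
  then have "(\<lambda>z. ennreal ((norm (indicator (ball 0 r) z *\<^sub>R h z))\<^sup>2)) \<in> borel_measurable borel"
    by measurable
  also have "(\<lambda>z. ennreal ((norm (indicator (ball 0 r) z *\<^sub>R h z))\<^sup>2)) = u"
    by (auto simp: u_def indicator_def fun_eq_iff)
  finally have u [measurable]: "u \<in> borel_measurable borel" .
  have [measurable]: "ball 0 r \<in> sets (borel :: complex measure)" by simp
  have cis_m [measurable]: "cis \<in> borel_measurable borel"
    by (intro borel_measurable_continuous_onI continuous_intros)
  have inner: "(\<integral>\<^sup>+t. u (cis t * z) * indicator {0..2 * pi} t \<partial>lborel)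
      = ennreal (2 * pi) * (\<Sum>n. ennreal ((norm (c n))\<^sup>2) * (ennreal (norm z ^ (2 * n)) * indicator (ball 0 r) z))" for z
  proof (cases "norm z < r")
    case True
    then have z: "norm z < 1" using r by simp
    have "(\<integral>\<^sup>+t. u (cis t * z) * indicator {0..2 * pi} t \<partial>lborel)
        = (\<integral>\<^sup>+t. ennreal ((norm (h (cis t * z)))\<^sup>2) * indicator {0..2 * pi} t \<partial>lborel)"
      using True by (intro nn_integral_cong) (simp add: u_def norm_mult)
    also have "\<dots> = ennreal (2 * pi * (\<Sum>n. (norm (c n))\<^sup>2 * norm z ^ (2 * n)))"
      by (rule nn_integral_has_integral_lebesgue'[OF _ gutzmer(2)[OF h z]]) auto
    also have "\<dots> = ennreal (2 * pi) * (\<Sum>n. ennreal ((norm (c n))\<^sup>2 * norm z ^ (2 * n)))"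
      using gutzmer(1)[OF h z] by (subst suminf_ennreal2) (auto simp: ennreal_mult suminf_nonneg)
    finally show ?thesis using True by (simp add: ennreal_mult)
  qed (simp add: u_def norm_mult)
  have "ennreal (2 * pi) * integral\<^sup>N lborel u = (\<integral>\<^sup>+t. integral\<^sup>N lborel u * indicator {0..2 * pi} t \<partial>lborel)"
    by (simp add: nn_integral_cmult mult.commute)
  also have "\<dots> = (\<integral>\<^sup>+t. (\<integral>\<^sup>+z. u (cis t * z) * indicator {0..2 * pi} t \<partial>lborel) \<partial>lborel)"
    by (intro nn_integral_cong) (simp add: nn_integral_multc nn_integral_lborel_rotation)
  also have "\<dots> = (\<integral>\<^sup>+z. (\<integral>\<^sup>+t. u (cis t * z) * indicator {0..2 * pi} t \<partial>lborel) \<partial>lborel)"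
    by (rule lborel_pair.Fubini') measurable
  also have "\<dots> = ennreal (2 * pi) * (\<integral>\<^sup>+z. (\<Sum>n. ennreal ((norm (c n))\<^sup>2) * (ennreal (norm (z::complex) ^ (2 * n)) * indicator (ball 0 r) z)) \<partial>lborel)"
    unfolding inner by (rule nn_integral_cmult) measurable
  also have "\<dots> = ennreal (2 * pi) * (\<Sum>n. ennreal ((norm (c n))\<^sup>2) * (\<integral>\<^sup>+z\<in>ball 0 r. ennreal (norm (z::complex) ^ (2 * n)) \<partial>lborel))"
    by (subst nn_integral_suminf) (simp_all add: nn_integral_cmult)
  also have "\<dots> = ennreal (2 * pi) * (\<Sum>n. ennreal (pi * (norm (c n))\<^sup>2 * r ^ (2 * Suc n) / Suc n))"
    using r unfolding nn_integral_ball_norm_power[OF r(1)]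
    by (simp add: ennreal_mult[symmetric] mult_ac del: power_Suc of_nat_Suc)
  finally have "integral\<^sup>N lborel u = (\<Sum>n. ennreal (pi * (norm (c n))\<^sup>2 * r ^ (2 * Suc n) / Suc n))"
    by (simp add: ennreal_mult_cancel_left del: power_Suc of_nat_Suc)
  then show ?thesis by (simp add: u_def[abs_def])
qed

section \<open>Clunie's inequality and the extremal function\<close>

lemma unit_disc_fps_sums:
  assumes "h holomorphic_on unit_disc" "h has_fps_expansion H" "norm w < 1"
  shows "(\<lambda>n. fps_nth H n * w ^ n) sums h w"
  using has_fps_expansion_imp_sums_complex[OF assms(2), of 1 w] assms(1,3)
  by (simp add: one_ereal_def)

text \<open>The coefficients of \<open>deriv g\<close> carry a factor \<open>Suc n\<close>; after
  squaring, one such factor cancels against the \<open>1 / Suc n\<close> of the area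
  integral.\<close>

lemma dirichlet_area_fps:
  fixes r :: real
  assumes g: "g holomorphic_on unit_disc" and G: "g has_fps_expansion G" and r: "0 < r" "r \<le> 1"
  shows "dirichlet_area r g = (\<Sum>n. ennreal (pi * (Suc n * r ^ (2 * Suc n) * (norm (fps_nth G (Suc n)))\<^sup>2)))"
proof -
  have "deriv g holomorphic_on unit_disc" using g by (intro holomorphic_deriv) auto
  from unit_disc_fps_sums[OF this has_fps_expansion_deriv[OF G]]
  have "dirichlet_area r g
      = (\<Sum>n. ennreal (pi * (norm (fps_nth (fps_deriv G) n))\<^sup>2 * r ^ (2 * Suc n) / Suc n))"
    unfolding dirichlet_area_def by (intro nn_integral_ball_norm_square r)
  also have "(\<lambda>n. pi * (norm (fps_nth (fps_deriv G) n))\<^sup>2 * r ^ (2 * Suc n) / Suc n)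
      = (\<lambda>n. pi * (Suc n * r ^ (2 * Suc n) * (norm (fps_nth G (Suc n)))\<^sup>2))"
    unfolding fps_deriv_nth Suc_eq_plus1[symmetric] norm_mult norm_of_nat
    by (simp add: power_mult_distrib power2_eq_square fun_eq_iff del: of_nat_Suc power_Suc)
  finally show ?thesis .
qed

text \<open>The subordination condition written for \<open>g = z / f\<close>, with \<open>w\<close> the Schwarz function
  and \<open>A = 2 (1 - \<beta>)\<close>.\<close>

definition subordination_ode :: "real \<Rightarrow> real \<Rightarrow> (complex \<Rightarrow> complex) \<Rightarrow> (complex \<Rightarrow> complex) \<Rightarrow> bool" where
  "subordination_ode \<alpha> A w g \<longleftrightarrow>
     (\<forall>z\<in>unit_disc. z * deriv g z = \<alpha> * w z * (z * deriv g z - A * g z))"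

lemma subordination_ode_fps:
  assumes "subordination_ode \<alpha> A w g" and G: "g has_fps_expansion G" and W: "w has_fps_expansion W"
  shows "of_nat n * fps_nth G n
    = \<alpha> * (\<Sum>i\<le>n. fps_nth W i * ((of_nat (n - i) - A) * fps_nth G (n - i)))"
proof -
  have *: "(\<lambda>z. z * deriv g z) has_fps_expansion fps_X * fps_deriv G"
    by (intro fps_expansion_intros G)
  have rhs: "(\<lambda>z. \<alpha> * w z * (z * deriv g z - A * g z)) has_fps_expansion
      fps_const (of_real \<alpha>) * W * (fps_X * fps_deriv G - fps_const (of_real A) * G)"
    by (intro fps_expansion_intros G W)
  have "eventually (\<lambda>z. z \<in> unit_disc) (nhds (0::complex))"
    by (intro eventually_nhds_in_open) auto
  then have ev: "eventually (\<lambda>z. \<alpha> * w z * (z * deriv g z - A * g z) = z * deriv g z) (nhds 0)"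
    by eventually_elim (use assms(1) in \<open>simp add: subordination_ode_def\<close>)
  note has_fps_expansion_cong[THEN iffD1, OF ev refl rhs]
  with * have "fps_X * fps_deriv G
      = fps_const (of_real \<alpha>) * W * (fps_X * fps_deriv G - fps_const (of_real A) * G)"
    by (rule fps_expansion_unique_complex)
  moreover have X: "fps_nth (fps_X * fps_deriv G) m = of_nat m * fps_nth G m" for m
    by (cases m) auto
  ultimately have "of_nat n * fps_nth G n
      = fps_nth (fps_const (of_real \<alpha>) * (W * (fps_X * fps_deriv G - fps_const (of_real A) * G))) n"
    by (metis mult.assoc)
  moreover have "fps_nth (fps_X * fps_deriv G - fps_const (of_real A) * G) m = (of_nat m - A) * fps_nth G m" for m
    by (simp add: X left_diff_distrib)
  ultimately show ?thesis
    by (simp only: fps_mult_left_const_nth fps_mult_nth[of W] atLeast0AtMost)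
qed

text \<open>Clunie's method: since \<open>w\<close> vanishes at the origin, truncating the series of
  \<open>z g' - A g\<close> below degree \<open>N\<close> does not change the coefficients of \<open>\<alpha> w (z g' - A g)\<close> up to degree \<open>N\<close>.\<close>

lemma clunie:
  assumes g: "g holomorphic_on unit_disc" "g has_fps_expansion G"
    and w: "w holomorphic_on unit_disc" "w 0 = 0" "\<And>z. z \<in> unit_disc \<Longrightarrow> norm (w z) \<le> 1"
    and ode: "subordination_ode \<alpha> A w g"
  shows "(\<Sum>n\<le>N. (real n)\<^sup>2 * (norm (fps_nth G n))\<^sup>2)
    \<le> (\<Sum>n<N. \<alpha>\<^sup>2 * (real n - A)\<^sup>2 * (norm (fps_nth G n))\<^sup>2)"
proof -
  define W where "W = fps_expansion w 0"
  have W: "w has_fps_expansion W"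
    unfolding W_def using w by (intro has_fps_expansion_fps_expansion[of unit_disc]) auto
  have W0: "fps_nth W 0 = 0" using has_fps_expansion_imp_0_eq_fps_nth_0[OF W] w by simp
  \<comment> \<open>Coefficients of \<open>z g' - A g\<close>, truncated below degree
    \<open>N\<close>.\<close>
  define q where "q n = (if n < N then (of_nat n - of_real A) * fps_nth G n else 0)" for n
  define Q where "Q z = (\<Sum>n<N. q n * z ^ n)" for z
  have Q_sums: "(\<lambda>n. q n * z ^ n) sums Q z" for z
    unfolding Q_def by (rule sums_finite) (auto simp: q_def)
  have norm_q: "(norm (q n))\<^sup>2 = (real n - A)\<^sup>2 * (norm (fps_nth G n))\<^sup>2" if "n < N" for n
  proof -
    have "of_nat n - of_real A = complex_of_real (real n - A)" by simp
    then show ?thesis using that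
      by (simp only: q_def if_True norm_mult norm_of_real power_mult_distrib power2_abs)
  qed
  define P where "P z = \<alpha> * w z * Q z" for z
  have hol_Q: "Q holomorphic_on unit_disc" unfolding Q_def by (intro holomorphic_intros)
  have hol_P: "P holomorphic_on unit_disc" unfolding P_def by (intro holomorphic_intros hol_Q w)
  have Q_fps: "Q has_fps_expansion Abs_fps q"
    by (rule has_fps_expansionI) (simp add: Q_sums)
  define p where "p = fps_const (of_real \<alpha>) * W * Abs_fps q"
  have p: "P has_fps_expansion p"
    unfolding P_def p_def by (intro fps_expansion_intros W Q_fps)
  have p_nth: "fps_nth p n = of_nat n * fps_nth G n" if "n \<le> N" for n
  proof -
    have "fps_nth p n = \<alpha> * (\<Sum>i\<le>n. fps_nth W i * q (n - i))"
      by (simp add: p_def mult.assoc fps_mult_nth[of W] atLeast0AtMost)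
    also have "(\<Sum>i\<le>n. fps_nth W i * q (n - i))
        = (\<Sum>i\<le>n. fps_nth W i * ((of_nat (n - i) - A) * fps_nth G (n - i)))"
    proof (intro sum.cong refl)
      fix i assume "i \<in> {..n}"
      then show "fps_nth W i * q (n - i) = fps_nth W i * ((of_nat (n - i) - A) * fps_nth G (n - i))"
        \<comment> \<open>Truncation changes a coefficient occurring here only for
          \<open>n = N\<close> and \<open>i = 0\<close>, and there the factor
          \<open>fps_nth W 0\<close> is zero.\<close>
        using that W0 by (cases "i = 0") (auto simp: q_def)
    qed
    finally show ?thesis using subordination_ode_fps[OF ode g(2) W, of n] by simp
  qed
  \<comment> \<open>Mean values of \<open>norm P ^ 2 \<le> \<alpha>\<^sup>2 * norm Q ^ 2\<close>
    over the circle of radius \<open>s < 1\<close>; terms of \<open>P\<close> beyond degree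
    \<open>N\<close> are discarded.\<close>
  have step: "(\<Sum>n\<le>N. (real n)\<^sup>2 * (norm (fps_nth G n))\<^sup>2 * s ^ (2 * n))
      \<le> (\<Sum>n<N. \<alpha>\<^sup>2 * (real n - A)\<^sup>2 * (norm (fps_nth G n))\<^sup>2 * s ^ (2 * n))" if s: "0 < s" "s < 1" for s
  proof -
    define z where "z = complex_of_real s"
    have z: "norm z = s" "norm z < 1" using s by (auto simp: z_def)
    note gp = gutzmer[OF unit_disc_fps_sums[OF hol_P p] z(2)]
    note gq = gutzmer[OF Q_sums z(2)]
    have "2 * pi * (\<Sum>n. (norm (fps_nth p n))\<^sup>2 * norm z ^ (2 * n))
        \<le> \<alpha>\<^sup>2 * (2 * pi * (\<Sum>n. (norm (q n))\<^sup>2 * norm z ^ (2 * n)))"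
    proof (rule has_integral_le[OF gp(2) has_integral_mult_right[OF gq(2)]])
      fix t :: real
      have "norm (w (cis t * z)) \<le> 1" using z by (intro w) (simp add: norm_mult)
      then have "(norm (w (cis t * z)))\<^sup>2 \<le> 1" by (simp add: power_le_one)
      then have "(norm (w (cis t * z)))\<^sup>2 * (\<alpha>\<^sup>2 * (norm (Q (cis t * z)))\<^sup>2) \<le> 1 * (\<alpha>\<^sup>2 * (norm (Q (cis t * z)))\<^sup>2)"
        by (intro mult_right_mono) auto
      then show "(norm (P (cis t * z)))\<^sup>2 \<le> \<alpha>\<^sup>2 * (norm (Q (cis t * z)))\<^sup>2"
        by (simp add: P_def norm_mult power_mult_distrib mult_ac)
    qed
    then have "(\<Sum>n. (norm (fps_nth p n))\<^sup>2 * s ^ (2 * n)) \<le> \<alpha>\<^sup>2 * (\<Sum>n. (norm (q n))\<^sup>2 * s ^ (2 * n))"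
      by (simp add: z mult.left_commute)
    also have "(\<Sum>n. (norm (q n))\<^sup>2 * s ^ (2 * n)) = (\<Sum>n<N. (norm (q n))\<^sup>2 * s ^ (2 * n))"
      by (rule suminf_finite) (auto simp: q_def)
    also have "\<alpha>\<^sup>2 * \<dots> = (\<Sum>n<N. \<alpha>\<^sup>2 * (real n - A)\<^sup>2 * (norm (fps_nth G n))\<^sup>2 * s ^ (2 * n))"
      by (simp add: norm_q sum_distrib_left mult_ac)
    finally have "(\<Sum>n. (norm (fps_nth p n))\<^sup>2 * s ^ (2 * n)) \<le> \<dots>" .
    moreover have "(\<Sum>n\<le>N. (norm (fps_nth p n))\<^sup>2 * s ^ (2 * n)) \<le> (\<Sum>n. (norm (fps_nth p n))\<^sup>2 * s ^ (2 * n))"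
      using gp(1) s by (intro sum_le_suminf) (auto simp: z)
    moreover have "(\<Sum>n\<le>N. (norm (fps_nth p n))\<^sup>2 * s ^ (2 * n)) = (\<Sum>n\<le>N. (real n)\<^sup>2 * (norm (fps_nth G n))\<^sup>2 * s ^ (2 * n))"
      by (intro sum.cong refl) (simp add: p_nth norm_mult power_mult_distrib)
    ultimately show ?thesis by simp
  qed
  have ev: "eventually (\<lambda>s::real. s \<in> {0<..<1}) (at_left 1)"
    by (rule eventually_at_left_real) simp
  \<comment> \<open>Both sides are polynomials in \<open>s\<close>, so the inequality survives as
    \<open>s\<close> tends to 1.\<close>
  have lim: "((\<lambda>s. \<Sum>n\<in>S. u n * s ^ (2 * n)) \<longlongrightarrow> (\<Sum>n\<in>S. u n * 1 ^ (2 * n))) (at_left (1::real))" for u S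
    by (intro tendsto_intros)
  have "(\<Sum>n\<le>N. (real n)\<^sup>2 * (norm (fps_nth G n))\<^sup>2 * 1 ^ (2 * n))
      \<le> (\<Sum>n<N. \<alpha>\<^sup>2 * (real n - A)\<^sup>2 * (norm (fps_nth G n))\<^sup>2 * 1 ^ (2 * n))"
    by (rule tendsto_le[OF _ lim lim]) (use ev in \<open>auto elim!: eventually_mono intro!: step\<close>)
  then show ?thesis by simp
qed

lemma subordination_ode_linear_coeffs:
  assumes "subordination_ode \<alpha> A (\<lambda>z. c * z) g" and G: "g has_fps_expansion G"
  shows "of_nat (Suc n) * fps_nth G (Suc n) = \<alpha> * c * (of_nat n - A) * fps_nth G n"
proof -
  have "(\<lambda>z. c * z) has_fps_expansion fps_const c * fps_X" by (intro fps_expansion_intros)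
  from subordination_ode_fps[OF assms this, of "Suc n"]
  have "of_nat (Suc n) * fps_nth G (Suc n)
     = \<alpha> * (\<Sum>i\<le>Suc n. fps_nth (fps_const c * fps_X) i * ((of_nat (Suc n - i) - A) * fps_nth G (Suc n - i)))" .
  also have "(\<Sum>i\<le>Suc n. fps_nth (fps_const c * fps_X) i * ((of_nat (Suc n - i) - A) * fps_nth G (Suc n - i)))
     = (\<Sum>i\<in>{1}. fps_nth (fps_const c * fps_X) i * ((of_nat (Suc n - i) - A) * fps_nth G (Suc n - i)))"
    by (rule sum.mono_neutral_right) (auto simp: fps_X_def)
  finally show ?thesis by simp
qed

text \<open>For linear \<open>w\<close> the equation becomes a two-term recursion, which determines
  all coefficients from the value at the origin.\<close>

lemma subordination_ode_linear_unique:
  assumes "subordination_ode \<alpha> A (\<lambda>z. c * z) g" "g holomorphic_on unit_disc"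
    and "subordination_ode \<alpha> A (\<lambda>z. c * z) h" "h holomorphic_on unit_disc"
    and "g 0 = h 0" "z \<in> unit_disc"
  shows "g z = h z"
proof -
  define G H where "G = fps_expansion g 0" and "H = fps_expansion h 0"
  have G: "g has_fps_expansion G" and H: "h has_fps_expansion H"
    unfolding G_def H_def using assms(2,4) by (auto intro!: has_fps_expansion_fps_expansion[of unit_disc])
  have "fps_nth G n = fps_nth H n" for n
  proof (induction n)
    case 0
    show ?case using assms(5) G H by (simp add: has_fps_expansion_imp_0_eq_fps_nth_0[symmetric])
  next
    case (Suc n)
    have "of_nat (Suc n) * fps_nth G (Suc n) = of_nat (Suc n) * fps_nth H (Suc n)"
      unfolding subordination_ode_linear_coeffs[OF assms(1) G] subordination_ode_linear_coeffs[OF assms(3) H] Suc ..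
    then show ?case by (simp del: of_nat_Suc)
  qed
  then have "(\<lambda>n. fps_nth G n * z ^ n) sums h z"
    using unit_disc_fps_sums[OF assms(4) H, of z] assms(6) by simp
  then show ?thesis
    using unit_disc_fps_sums[OF assms(2) G, of z] assms(6) sums_unique2 by auto
qed

text \<open>\<open>z / f\<close> for a rotation \<open>f\<close> of \<open>k_fun\<close>, when \<open>A = 2 (1 - \<beta>)\<close>.\<close>

definition extremal_quotient :: "real \<Rightarrow> real \<Rightarrow> complex \<Rightarrow> complex \<Rightarrow> complex" where
  "extremal_quotient \<alpha> A c z = (1 - \<alpha> * c * z) powr A"

lemma extremal_quotient_0: "extremal_quotient \<alpha> A c 0 = 1"
  by (simp add: extremal_quotient_def)

context
  fixes \<alpha> A :: real and c :: complex
  assumes \<alpha>: "0 < \<alpha>" "\<alpha> \<le> 1" and c: "norm c = 1"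
begin

lemma norm_arg_less_1: assumes "z \<in> unit_disc" shows "norm (\<alpha> * c * z) < 1"
proof -
  have "norm (\<alpha> * c * z) = \<alpha> * norm z" using \<alpha> c by (simp add: norm_mult)
  also have "\<dots> \<le> 1 * norm z" using \<alpha> by (intro mult_right_mono) auto
  finally show ?thesis using assms by simp
qed

lemma base_notin_nonpos_Reals: assumes "z \<in> unit_disc" shows "1 - \<alpha> * c * z \<notin> \<real>\<^sub>\<le>\<^sub>0"
  using norm_arg_less_1[OF assms] complex_Re_le_cmod[of "\<alpha> * c * z"]
  by (auto simp: complex_nonpos_Reals_iff)

lemma base_nonzero: "z \<in> unit_disc \<Longrightarrow> 1 - \<alpha> * c * z \<noteq> 0"
  using base_notin_nonpos_Reals by fastforce

lemma extremal_quotient_holomorphic: "extremal_quotient \<alpha> A c holomorphic_on unit_disc"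
  unfolding extremal_quotient_def
  by (intro holomorphic_intros) (use base_notin_nonpos_Reals in auto)

lemma extremal_quotient_nonzero: "z \<in> unit_disc \<Longrightarrow> extremal_quotient \<alpha> A c z \<noteq> 0"
  using base_nonzero by (simp add: extremal_quotient_def)

lemma deriv_extremal_quotient:
  assumes "z \<in> unit_disc"
  shows "(1 - \<alpha> * c * z) * deriv (extremal_quotient \<alpha> A c) z = - \<alpha> * c * A * extremal_quotient \<alpha> A c z"
proof -
  have "(extremal_quotient \<alpha> A c has_field_derivative
      A * (1 - \<alpha> * c * z) powr (A - 1) * (- \<alpha> * c)) (at z)"
    unfolding extremal_quotient_def using base_notin_nonpos_Reals[OF assms]
    by (auto intro!: derivative_eq_intros)
  then have "deriv (extremal_quotient \<alpha> A c) z = A * (1 - \<alpha> * c * z) powr (A - 1) * (- \<alpha> * c)"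
    by (rule DERIV_imp_deriv)
  moreover have "(1 - \<alpha> * c * z) powr A = (1 - \<alpha> * c * z) * (1 - \<alpha> * c * z) powr (A - 1)"
    using base_nonzero[OF assms] by (simp add: powr_diff)
  ultimately show ?thesis by (simp add: extremal_quotient_def)
qed

lemma extremal_quotient_ode: "subordination_ode \<alpha> A (\<lambda>z. c * z) (extremal_quotient \<alpha> A c)"
  unfolding subordination_ode_def
proof
  fix z assume "z \<in> unit_disc"
  then have "(1 - \<alpha> * c * z) * deriv (extremal_quotient \<alpha> A c) z = - \<alpha> * c * A * extremal_quotient \<alpha> A c z"
    by (rule deriv_extremal_quotient)
  then have "z * ((1 - \<alpha> * c * z) * deriv (extremal_quotient \<alpha> A c) z) = z * (- \<alpha> * c * A * extremal_quotient \<alpha> A c z)"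
    by (rule arg_cong)
  then
  show "z * deriv (extremal_quotient \<alpha> A c) z
      = \<alpha> * (c * z) * (z * deriv (extremal_quotient \<alpha> A c) z - A * extremal_quotient \<alpha> A c z)"
    by (simp add: algebra_simps)
qed

end

text \<open>With \<open>c = exp (\<i> * \<theta>)\<close> the outer factor
  \<open>exp (- \<i> * \<theta>)\<close> cancels the \<open>c\<close> coming from the leading factor
  \<open>z\<close> of \<open>k_fun\<close>; conversely \<open>\<theta> = Arg c\<close>.\<close>

lemma rotation_of_k_fun_iff:
  "rotation_of (k_fun \<alpha> \<beta>) f \<longleftrightarrow>
    (\<exists>c. norm c = 1 \<and> (\<forall>z\<in>unit_disc. f z = z / extremal_quotient \<alpha> (2 * (1 - \<beta>)) c z))"
proof -
  have *: "exp (- \<i> * of_real \<theta>) * k_fun \<alpha> \<beta> (exp (\<i> * of_real \<theta>) * z)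
      = z / extremal_quotient \<alpha> (2 * (1 - \<beta>)) (exp (\<i> * of_real \<theta>)) z" for \<theta> z
  proof -
    have "complex_of_real (- 2 * (1 - \<beta>)) = - complex_of_real (2 * (1 - \<beta>))" by simp
    then show ?thesis
      by (simp only: k_fun_def extremal_quotient_def powr_minus)
        (simp add: exp_minus divide_inverse mult.assoc mult.left_commute)
  qed
  show ?thesis
  proof
    assume "rotation_of (k_fun \<alpha> \<beta>) f"
    then obtain \<theta> where "\<forall>z\<in>unit_disc. f z = z / extremal_quotient \<alpha> (2 * (1 - \<beta>)) (exp (\<i> * of_real \<theta>)) z"
      unfolding rotation_of_def * by blast
    then show "\<exists>c. norm c = 1 \<and> (\<forall>z\<in>unit_disc. f z = z / extremal_quotient \<alpha> (2 * (1 - \<beta>)) c z)"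
      by (intro exI[of _ "exp (\<i> * of_real \<theta>)"]) simp
  next
    assume "\<exists>c. norm c = 1 \<and> (\<forall>z\<in>unit_disc. f z = z / extremal_quotient \<alpha> (2 * (1 - \<beta>)) c z)"
    then obtain c where c: "norm c = 1" "\<forall>z\<in>unit_disc. f z = z / extremal_quotient \<alpha> (2 * (1 - \<beta>)) c z"
      by blast
    have "c = exp (\<i> * of_real (Arg c))"
      using c(1) Arg_eq[of c] by fastforce
    then show "rotation_of (k_fun \<alpha> \<beta>) f"
      unfolding rotation_of_def * using c(2) by metis
  qed
qed

section \<open>The extremal problem\<close>

context
  fixes f g :: "complex \<Rightarrow> complex"
  assumes g: "g holomorphic_on unit_disc" "\<And>z. z \<in> unit_disc \<Longrightarrow> g z \<noteq> 0" "g 0 = 1"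
    and f: "\<And>z. z \<in> unit_disc \<Longrightarrow> f z = z / g z"
begin

lemma z_over_quotient: "z \<in> unit_disc \<Longrightarrow> z_over f z = g z"
  using f[of z] g by (simp add: z_over_def)

lemma deriv_quotient:
  assumes "z \<in> unit_disc"
  shows "deriv f z = (g z - z * deriv g z) / (g z)\<^sup>2"
proof -
  have "eventually (\<lambda>w. w \<in> unit_disc) (nhds z)"
    using assms by (intro eventually_nhds_in_open) auto
  then have "eventually (\<lambda>w. f w = w / g w) (nhds z)"
    by eventually_elim (rule f)
  then have "deriv f z = deriv (\<lambda>w. w / g w) z"
    by (rule deriv_cong_ev) simp
  moreover have "(g has_field_derivative deriv g z) (at z)"
    using g(1) assms by (intro holomorphic_derivI[of _ unit_disc]) auto
  then have "((\<lambda>w. w / g w) has_field_derivative (g z - z * deriv g z) / (g z)\<^sup>2) (at z)"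
    using g(2)[OF assms] by (auto intro!: derivative_eq_intros simp: power2_eq_square)
  ultimately show ?thesis by (simp add: DERIV_imp_deriv)
qed

lemma quotient_in_class_A: "f \<in> class_A"
proof -
  have "(\<lambda>z. z / g z) holomorphic_on unit_disc"
    using g by (intro holomorphic_intros) auto
  then have "f holomorphic_on unit_disc"
    by (rule holomorphic_transform) (simp add: f)
  then show ?thesis
    using f[of 0] deriv_quotient[of 0] g(3) by (simp add: class_A_def)
qed

lemma log_quot_quotient: "z \<in> unit_disc \<Longrightarrow> log_quot f z = 1 - z * deriv g z / g z"
  unfolding log_quot_def by (simp add: deriv_quotient f g(2) power2_eq_square divide_simps)

lemma dirichlet_area_z_over: "r \<le> 1 \<Longrightarrow> dirichlet_area r (z_over f) = dirichlet_area r g"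
proof -
  assume r: "r \<le> 1"
  have "deriv (z_over f) z = deriv g z" if "z \<in> ball 0 r" for z
  proof (rule deriv_cong_ev[OF _ refl])
    have "eventually (\<lambda>w. w \<in> unit_disc) (nhds z)"
      using that r by (intro eventually_nhds_in_open) auto
    then show "eventually (\<lambda>w. z_over f w = g w) (nhds z)"
      by eventually_elim (rule z_over_quotient)
  qed
  then show ?thesis
    unfolding dirichlet_area_def by (intro nn_integral_cong) (auto simp: indicator_def)
qed

text \<open>Since \<open>log_quot f z = 1 - z g' / g\<close>, numerator and denominator of the
  defining quotient become \<open>- z g' / g\<close> and \<open>(A g - z g') / g\<close>, and
  \<open>g\<close> cancels.\<close>

lemma class_S_quotient_iff:
  fixes A :: real
  assumes A: "A = 2 * (1 - \<beta>)"
  shows "f \<in> class_S \<alpha> \<beta> \<longleftrightarrow> (\<forall>z\<in>unit_disc. A * g z - z * deriv g z \<noteq> 0 \<and>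
      norm (z * deriv g z / (A * g z - z * deriv g z)) < \<alpha>)"
proof -
  have "(z \<noteq> 0 \<longrightarrow> f z \<noteq> 0) \<and> log_quot f z + 1 - 2 * of_real \<beta> \<noteq> 0 \<and>
      norm ((log_quot f z - 1) / (log_quot f z + 1 - 2 * of_real \<beta>)) < \<alpha>
    \<longleftrightarrow> A * g z - z * deriv g z \<noteq> 0 \<and> norm (z * deriv g z / (A * g z - z * deriv g z)) < \<alpha>"
    if z: "z \<in> unit_disc" for z
  proof -
    have 1: "log_quot f z + 1 - 2 * of_real \<beta> = (A * g z - z * deriv g z) / g z"
      using g(2)[OF z] by (simp add: log_quot_quotient[OF z] A field_simps)
    have 2: "log_quot f z - 1 = - (z * deriv g z) / g z"
      using log_quot_quotient[OF z] by simp
    show ?thesis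
      unfolding 1 2 using f[OF z] g(2)[OF z] by (simp add: norm_divide)
  qed
  then show ?thesis using quotient_in_class_A by (auto simp: class_S_def)
qed

end

lemma class_S_obtain_subordination:
  assumes f: "f \<in> class_S \<alpha> \<beta>" and g: "z_over f holomorphic_on unit_disc" "\<And>z. z \<in> unit_disc \<Longrightarrow> z_over f z \<noteq> 0"
    and \<alpha>: "0 < \<alpha>"
  obtains w where "w holomorphic_on unit_disc" "w 0 = 0" "\<And>z. z \<in> unit_disc \<Longrightarrow> norm (w z) < 1"
    "subordination_ode \<alpha> (2 * (1 - \<beta>)) w (z_over f)" "\<And>z. z \<in> unit_disc \<Longrightarrow> f z = z / z_over f z"
proof -
  define A where "A = 2 * (1 - \<beta>)"
  define h where "h = z_over f"
  have f_eq: "f z = z / h z" if "z \<in> unit_disc" for z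
    using f that by (auto simp: h_def z_over_def class_S_def class_A_def)
  have h: "h holomorphic_on unit_disc" "\<And>z. z \<in> unit_disc \<Longrightarrow> h z \<noteq> 0" "h 0 = 1"
    using g by (auto simp: h_def z_over_def)
  have S: "A * h z - z * deriv h z \<noteq> 0 \<and> norm (z * deriv h z / (A * h z - z * deriv h z)) < \<alpha>"
    if "z \<in> unit_disc" for z
    using class_S_quotient_iff[of h f A \<beta> \<alpha>] h f_eq f that by (auto simp: A_def)
  \<comment> \<open>The subordination equation solved for \<open>w\<close>; the defining inequality
    of the class is exactly \<open>norm (w z) < 1\<close>.\<close>
  define w where "w z = - (z * deriv h z) / (\<alpha> * (A * h z - z * deriv h z))" for z
  have "w holomorphic_on unit_disc"
  proof -
    have "\<alpha> * (A * h z - z * deriv h z) \<noteq> 0" if "z \<in> unit_disc" for z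
      using S[OF that] \<alpha> by simp
    then show ?thesis unfolding w_def using h(1) by (intro holomorphic_intros) auto
  qed
  moreover have "w 0 = 0" by (simp add: w_def)
  moreover have "norm (w z) < 1" if "z \<in> unit_disc" for z
  proof -
    have "norm (w z) = norm (z * deriv h z / (A * h z - z * deriv h z)) / \<alpha>"
      using \<alpha> by (simp add: w_def norm_divide norm_mult)
    then show ?thesis using S[OF that] \<alpha> by simp
  qed
  moreover have "subordination_ode \<alpha> A w h"
    unfolding subordination_ode_def
  proof
    fix z assume "z \<in> unit_disc"
    then show "z * deriv h z = \<alpha> * w z * (z * deriv h z - A * h z)"
      using S[of z] \<alpha> by (simp add: w_def divide_simps) (simp add: algebra_simps)
  qed
  ultimately show ?thesis using f_eq that unfolding A_def h_def by blast
qed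

section \<open>Extremal coefficients and the hypergeometric series\<close>

definition extremal_coeff_sq :: "real \<Rightarrow> real \<Rightarrow> nat \<Rightarrow> real" where
  "extremal_coeff_sq \<alpha> A n = (norm (fps_nth (fps_expansion (extremal_quotient \<alpha> A 1) 0) n))\<^sup>2"

text \<open>Taking moduli in the recursion removes \<open>c\<close>, so all rotations obey the same
  recursion.\<close>

lemma linear_coeff_sq:
  assumes "subordination_ode \<alpha> A (\<lambda>z. c * z) g" and G: "g has_fps_expansion G" and c: "norm c = 1"
  shows "(real (Suc n))\<^sup>2 * (norm (fps_nth G (Suc n)))\<^sup>2 = \<alpha>\<^sup>2 * (real n - A)\<^sup>2 * (norm (fps_nth G n))\<^sup>2"
proof -
  have "complex_of_real (real (Suc n)) * fps_nth G (Suc n) = of_real \<alpha> * c * of_real (real n - A) * fps_nth G n"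
    using subordination_ode_linear_coeffs[OF assms(1,2)] by simp
  then have "norm (complex_of_real (real (Suc n)) * fps_nth G (Suc n)) = norm (of_real \<alpha> * c * of_real (real n - A) * fps_nth G n)"
    by (rule arg_cong)
  then have "(real (Suc n) * norm (fps_nth G (Suc n)))\<^sup>2 = (\<bar>\<alpha>\<bar> * \<bar>real n - A\<bar> * norm (fps_nth G n))\<^sup>2"
    using c by (simp only: norm_mult norm_of_real mult_1_right abs_of_nat)
  then show ?thesis by (simp only: power_mult_distrib power2_abs)
qed

context
  fixes \<alpha> A :: real
  assumes \<alpha>: "0 < \<alpha>" "\<alpha> \<le> 1" and A: "0 < A" "A \<le> 2"
begin

lemma extremal_quotient_expansion:
  "norm c = 1 \<Longrightarrow> extremal_quotient \<alpha> A c has_fps_expansion fps_expansion (extremal_quotient \<alpha> A c) 0"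
  using extremal_quotient_holomorphic[OF \<alpha>] by (intro has_fps_expansion_fps_expansion[of unit_disc]) auto

lemma extremal_coeff_sq_0: "extremal_coeff_sq \<alpha> A 0 = 1"
  using has_fps_expansion_imp_0_eq_fps_nth_0[OF extremal_quotient_expansion[of 1]]
  by (simp add: extremal_coeff_sq_def extremal_quotient_0)

lemma extremal_coeff_sq_Suc:
  "(real (Suc n))\<^sup>2 * extremal_coeff_sq \<alpha> A (Suc n) = \<alpha>\<^sup>2 * (real n - A)\<^sup>2 * extremal_coeff_sq \<alpha> A n"
  unfolding extremal_coeff_sq_def
  by (intro linear_coeff_sq[OF extremal_quotient_ode extremal_quotient_expansion] \<alpha>) auto

text \<open>The square of the binomial coefficient of \<open>A\<close> over \<open>Suc n\<close>
  times \<open>\<alpha> ^ Suc n\<close>: up to sign, \<open>A (A - 1) ... (A - n)\<close> is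
  \<open>A * pochhammer (1 - A) n\<close>.\<close>

lemma extremal_coeff_sq_eq:
  "extremal_coeff_sq \<alpha> A (Suc n) = \<alpha> ^ (2 * Suc n) * A\<^sup>2 * (pochhammer (1 - A) n)\<^sup>2 / (fact (Suc n))\<^sup>2"
proof (induction n)
  case 0
  show ?case using extremal_coeff_sq_Suc[of 0] extremal_coeff_sq_0 by simp
next
  case (Suc n)
  have "extremal_coeff_sq \<alpha> A (Suc (Suc n))
      = \<alpha>\<^sup>2 * (real (Suc n) - A)\<^sup>2 * extremal_coeff_sq \<alpha> A (Suc n) / (real (Suc (Suc n)))\<^sup>2"
    unfolding extremal_coeff_sq_Suc[of "Suc n", symmetric] by (simp del: of_nat_Suc)
  also have "real (Suc n) - A = 1 - A + real n" by simp
  also have "\<alpha>\<^sup>2 * (1 - A + real n)\<^sup>2 * extremal_coeff_sq \<alpha> A (Suc n) / (real (Suc (Suc n)))\<^sup>2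
    = \<alpha> ^ (2 * Suc (Suc n)) * A\<^sup>2 * (pochhammer (1 - A) (Suc n))\<^sup>2 / (fact (Suc (Suc n)))\<^sup>2"
    unfolding Suc pochhammer_Suc fact_Suc[of "Suc n"]
    by (simp add: power_mult_distrib power2_eq_square mult_ac del: of_nat_Suc fact_Suc)
  finally show ?case .
qed

text \<open>\<open>Suc n / (fact (Suc n))\<^sup>2 = 1 / (fact (Suc n) * fact n)\<close>, and the two
  factorials are \<open>pochhammer 2 n\<close> and \<open>pochhammer 1 n\<close>.\<close>

lemma extremal_coeff_sq_hypergeo:
  fixes \<rho> :: real
  shows
  "Suc n * \<rho> ^ (2 * Suc n) * extremal_coeff_sq \<alpha> A (Suc n)
    = \<alpha>\<^sup>2 * A\<^sup>2 * \<rho>\<^sup>2 * (pochhammer (1 - A) n * pochhammer (1 - A) n /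
        (pochhammer 2 n * pochhammer 1 n) * (\<alpha>\<^sup>2 * \<rho>\<^sup>2) ^ n)"
proof -
  have "pochhammer 2 n = (fact (Suc n) :: real)"
    using pochhammer_rec[of "1::real" n] by (simp add: pochhammer_fact)
  then show ?thesis
    unfolding extremal_coeff_sq_eq pochhammer_fact[symmetric] fact_Suc[of n]
    by (simp add: power_mult_distrib power2_eq_square power_mult mult_ac del: of_nat_Suc fact_Suc)
qed

end

theorem theorem1p3:
  fixes \<alpha> \<beta> \<rho> :: real
  defines "F \<equiv> {f \<in> class_S \<alpha> \<beta>.
      z_over f holomorphic_on unit_disc \<and> (\<forall>z\<in>unit_disc. z_over f z \<noteq> 0)}"
  defines "M \<equiv> ennreal (4 * pi * \<alpha>\<^sup>2 * (1 - \<beta>)\<^sup>2 * \<rho>\<^sup>2 *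
      hyp2F1 (2 * \<beta> - 1) (2 * \<beta> - 1) 2 (\<alpha>\<^sup>2 * \<rho>\<^sup>2))"
  assumes "0 < \<alpha>" "\<alpha> \<le> 1" "0 \<le> \<beta>" "\<beta> < 1" "0 < \<rho>" "\<rho> \<le> 1"
  shows "is_maximum M ((\<lambda>f. dirichlet_area \<rho> (z_over f)) ` F)
    \<and> {f \<in> F. dirichlet_area \<rho> (z_over f) = M} = {f. rotation_of (k_fun \<alpha> \<beta>) f}"
proof -
  define A where "A = 2 * (1 - \<beta>)"
  have \<alpha>: "0 < \<alpha>" "\<alpha> \<le> 1" and \<rho>: "0 < \<rho>" "\<rho> \<le> 1" and A: "0 < A" "A \<le> 2"
    using assms by (auto simp: A_def)
  interpret weighted_recursion \<alpha> A \<rho>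
    by unfold_locales (use \<alpha> \<rho> A in auto)
  define y where "y = extremal_coeff_sq \<alpha> A"
  note y = extremal_coeff_sq_Suc[OF \<alpha> A, folded y_def] extremal_coeff_sq_0[OF \<alpha> A, folded y_def]
  have y0: "0 \<le> y n" for n by (simp add: y_def extremal_coeff_sq_def)
  define Y where "Y n = Suc n * \<rho> ^ (2 * Suc n) * y (Suc n)" for n
  have Y0: "0 \<le> Y n" for n using y0 \<rho> by (simp add: Y_def)
  have Y: "summable Y"
    unfolding Y_def by (rule summable_weighted_extremal[OF y])
  have M: "M = ennreal (pi * suminf Y)"
  proof -
    define T where "T n = pochhammer (2 * \<beta> - 1) n * pochhammer (2 * \<beta> - 1) n /
        (pochhammer 2 n * pochhammer 1 n) * (\<alpha>\<^sup>2 * \<rho>\<^sup>2) ^ n" for n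
    have YT: "Y n = \<alpha>\<^sup>2 * A\<^sup>2 * \<rho>\<^sup>2 * T n" for n
    proof -
      have "1 - A = 2 * \<beta> - 1" by (simp add: A_def)
      then show ?thesis unfolding Y_def y_def T_def extremal_coeff_sq_hypergeo[OF \<alpha> A] by (simp only:)
    qed
    \<comment> \<open>Convergence of the hypergeometric series, even at argument 1, is inherited
      from \<open>Y\<close> because the constant factor is nonzero.\<close>
    have "summable T" using Y \<alpha> A \<rho> by (simp add: YT[abs_def] summable_cmult_iff)
    then have "suminf Y = \<alpha>\<^sup>2 * A\<^sup>2 * \<rho>\<^sup>2 * hyp2F1 (2 * \<beta> - 1) (2 * \<beta> - 1) 2 (\<alpha>\<^sup>2 * \<rho>\<^sup>2)"
      unfolding hyp2F1_series T_def[symmetric] YT[abs_def] by (rule suminf_mult)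
    moreover have "A\<^sup>2 = 4 * (1 - \<beta>)\<^sup>2" by (simp only: A_def power_mult_distrib) simp
    ultimately show ?thesis by (simp add: M_def mult_ac)
  qed

  have rotation: "f \<in> F \<and> dirichlet_area \<rho> (z_over f) = M" if rot: "rotation_of (k_fun \<alpha> \<beta>) f" for f
  proof -
    obtain c where c: "norm c = 1" and f: "\<And>z. z \<in> unit_disc \<Longrightarrow> f z = z / extremal_quotient \<alpha> A c z"
      using rot unfolding rotation_of_k_fun_iff A_def by blast
    let ?g = "extremal_quotient \<alpha> A c"
    note g = extremal_quotient_holomorphic[OF \<alpha> c] extremal_quotient_nonzero[OF \<alpha> c] extremal_quotient_0
    have "A * ?g z - z * deriv ?g z \<noteq> 0 \<and>
        norm (z * deriv ?g z / (A * ?g z - z * deriv ?g z)) < \<alpha>" if z: "z \<in> unit_disc" for z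
    proof -
      have d: "(1 - \<alpha> * c * z) \<noteq> 0" by (rule base_nonzero[OF \<alpha> c z])
      then have e: "deriv ?g z = - \<alpha> * c * A * ?g z / (1 - \<alpha> * c * z)"
        using deriv_extremal_quotient[OF \<alpha> c z, of A] by (simp add: field_simps)
      have 1: "A * ?g z - z * deriv ?g z = A * ?g z / (1 - \<alpha> * c * z)"
        unfolding e using d by (simp add: field_simps)
      \<comment> \<open>For a rotation the quotient is a linear function of modulus
        \<open>\<alpha> * norm z\<close>, which is below \<alpha>.\<close>
      have 2: "z * deriv ?g z / (A * ?g z - z * deriv ?g z) = - \<alpha> * c * z"
        unfolding 1 unfolding e using d A g(2)[OF z] by (simp add: field_simps)
      have "norm (- \<alpha> * c * z) < \<alpha>" using \<alpha> c z by (simp add: norm_mult)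
      then show ?thesis unfolding 2 using 1 d A g(2)[OF z] by simp
    qed
    then have "f \<in> class_S \<alpha> \<beta>"
      using class_S_quotient_iff[of ?g f A \<beta> \<alpha>] g f A_def by blast
    moreover have quot: "z_over f z = ?g z" if "z \<in> unit_disc" for z
      using z_over_quotient[of ?g f] g f that by blast
    then have "z_over f holomorphic_on unit_disc"
      by (intro holomorphic_transform[OF g(1)]) simp
    ultimately have "f \<in> F"
      using quot g(2) by (auto simp: F_def)
    define x where "x n = (norm (fps_nth (fps_expansion ?g 0) n))\<^sup>2" for n
    note G = extremal_quotient_expansion[OF \<alpha> A c]
    have xy: "x n = y n" for n
    proof (induction n)
      case 0
      show ?case using has_fps_expansion_imp_0_eq_fps_nth_0[OF G] y(2) g(3) by (simp add: x_def)
    next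
      case (Suc n)
      have "(real (Suc n))\<^sup>2 * x (Suc n) = (real (Suc n))\<^sup>2 * y (Suc n)"
        unfolding y(1) Suc[symmetric] x_def by (rule linear_coeff_sq[OF extremal_quotient_ode[OF \<alpha> c] G c])
      then show ?case by (simp del: of_nat_Suc)
    qed
    have "dirichlet_area \<rho> (z_over f) = (\<Sum>n. ennreal (pi * Y n))"
      using dirichlet_area_z_over[of ?g f \<rho>] g f \<rho>(2)
      unfolding dirichlet_area_fps[OF g(1) G \<rho>] Y_def xy[symmetric] x_def by simp
    also have "\<dots> = M"
      unfolding M suminf_mult[OF Y, symmetric] using Y0 Y by (intro suminf_ennreal2 summable_mult) auto
    finally show ?thesis using \<open>f \<in> F\<close> by simp
  qed

  have bound: "dirichlet_area \<rho> (z_over f) \<le> M \<and>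
      (dirichlet_area \<rho> (z_over f) = M \<longrightarrow> rotation_of (k_fun \<alpha> \<beta>) f)" if fF: "f \<in> F" for f
  proof -
    define g where "g = z_over f"
    have g: "g holomorphic_on unit_disc" "\<And>z. z \<in> unit_disc \<Longrightarrow> g z \<noteq> 0" "g 0 = 1"
      using fF by (auto simp: F_def g_def z_over_def)
    obtain w where w: "w holomorphic_on unit_disc" "w 0 = 0" "\<And>z. z \<in> unit_disc \<Longrightarrow> norm (w z) < 1"
      and ode: "subordination_ode \<alpha> A w g" and f: "\<And>z. z \<in> unit_disc \<Longrightarrow> f z = z / g z"
      using class_S_obtain_subordination[of f \<alpha> \<beta>] fF \<alpha>(1) unfolding F_def g_def A_def by blast
    define G where "G = fps_expansion g 0"
    have G: "g has_fps_expansion G"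
      unfolding G_def using g by (intro has_fps_expansion_fps_expansion[of unit_disc]) auto
    define x where "x n = (norm (fps_nth G n))\<^sup>2" for n
    have G0: "fps_nth G 0 = 1" using has_fps_expansion_imp_0_eq_fps_nth_0[OF G] g(3) by simp
    then have x0: "x 0 = 1" by (simp add: x_def)
    have x: "(real m)\<^sup>2 * x m \<le> excess x m" for m
    proof -
      have "(\<Sum>n\<le>m. (real n)\<^sup>2 * x n) \<le> (\<Sum>n<m. \<alpha>\<^sup>2 * (real n - A)\<^sup>2 * x n)"
        unfolding x_def by (rule clunie[OF g(1) G w(1,2) _ ode]) (use w(3) in \<open>auto intro: less_imp_le\<close>)
      then show ?thesis by (simp add: excess_def lessThan_Suc_atMost[symmetric])
    qed
    have x1: "x 1 \<le> y 1"
      using x[of 1] excess_1[of x, OF x0] y(1)[of 0] y(2) by simp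
    define X where "X n = Suc n * \<rho> ^ (2 * Suc n) * x (Suc n)" for n
    have X0: "0 \<le> X n" for n using \<rho> by (simp add: X_def x_def)
    have area: "dirichlet_area \<rho> (z_over f) = (\<Sum>n. ennreal (pi * X n))"
      unfolding g_def[symmetric] dirichlet_area_fps[OF g(1) G \<rho>] X_def x_def ..
    have le: "(\<Sum>n. ennreal (pi * X n)) \<le> ennreal (pi * (suminf Y - gap * (y 1 - x 1)))"
    proof (rule suminf_le_const[OF summableI])
      fix d
      \<comment> \<open>One more term is added so that the sum is nonempty and the loss
        \<open>gap * (y 1 - x 1)\<close> is available also for \<open>d = 0\<close>.\<close>
      have "(\<Sum>n<d. X n) \<le> (\<Sum>n<Suc d. X n)" using X0 by simp
      also have "\<dots> \<le> (\<Sum>n<Suc d. Y n) - gap * (y 1 - x 1)"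
        using weighted_partial_sum_le[of x y, OF x x0 y, where d = "Suc d"] by (simp only: X_def Y_def) simp
      also have "(\<Sum>n<Suc d. Y n) \<le> suminf Y"
        using Y Y0 by (intro sum_le_suminf) auto
      finally have "pi * (\<Sum>n<d. X n) \<le> pi * (suminf Y - gap * (y 1 - x 1))" by simp
      then show "(\<Sum>n<d. ennreal (pi * X n)) \<le> ennreal (pi * (suminf Y - gap * (y 1 - x 1)))"
        using X0 by (simp add: sum_distrib_left ennreal_leI)
    qed
    have "dirichlet_area \<rho> (z_over f) \<le> M"
      unfolding area M using gap_pos x1 by (intro order.trans[OF le] ennreal_leI mult_left_mono) auto
    moreover have "rotation_of (k_fun \<alpha> \<beta>) f" if eq: "dirichlet_area \<rho> (z_over f) = M"
    proof -
      have "x 1 = y 1"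
      proof (rule ccontr)
        assume "x 1 \<noteq> y 1"
        then have pos: "0 < gap * (y 1 - x 1)" using x1 gap_pos by simp
        \<comment> \<open>Negative reals become 0 in \<open>ennreal\<close>, so the strict
          inequality requires \<open>suminf Y\<close> to be positive.\<close>
        have "Y 0 \<le> suminf Y" using sum_le_suminf[OF Y, of "{0}"] Y0 by simp
        moreover have "0 < Y 0" using y(1)[of 0] y(2) \<alpha> A \<rho> by (simp add: Y_def)
        ultimately have "ennreal (pi * (suminf Y - gap * (y 1 - x 1))) < M"
          unfolding M using pos by (intro ennreal_lessI) auto
        then show False using le eq area by simp
      qed
      then have "(norm (fps_nth G 1))\<^sup>2 = (\<alpha> * A)\<^sup>2"
        using y(1)[of 0] y(2) by (simp add: x_def power_mult_distrib)
      then have G1: "norm (fps_nth G 1) = \<alpha> * A"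
        using \<alpha> A by (simp add: power2_eq_iff_nonneg)
      define W where "W = fps_expansion w 0"
      have W: "w has_fps_expansion W"
        unfolding W_def using w by (intro has_fps_expansion_fps_expansion[of unit_disc]) auto
      have W0: "fps_nth W 0 = 0" using has_fps_expansion_imp_0_eq_fps_nth_0[OF W] w(2) by simp
      \<comment> \<open>The first coefficient of the equation turns maximal
        \<open>norm (fps_nth G 1)\<close> into \<open>norm (deriv w 0) = 1\<close>, the equality
        case of the Schwarz lemma.\<close>
      have "fps_nth G 1 = - (\<alpha> * A * fps_nth W 1)"
        using subordination_ode_fps[OF ode G W, of 1] W0 G0 by simp
      then have "norm (fps_nth W 1) = 1" using G1 \<alpha> A by (simp add: norm_mult)
      moreover have "fps_nth W 1 = deriv w 0" using fps_nth_fps_expansion[OF W, of 1] by simp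
      ultimately have "norm (deriv w 0) = 1" by simp
      then obtain c where c: "norm c = 1" "\<And>z. norm z < 1 \<Longrightarrow> w z = c * z"
        using Schwarz_Lemma(3)[OF w(1,2), of 0] w(3) by auto
      have "subordination_ode \<alpha> A (\<lambda>z. c * z) g"
        using ode c(2) by (simp add: subordination_ode_def)
      then have "g z = extremal_quotient \<alpha> A c z" if "z \<in> unit_disc" for z
        using subordination_ode_linear_unique[OF _ g(1) extremal_quotient_ode[OF \<alpha> c(1)]
            extremal_quotient_holomorphic[OF \<alpha> c(1)] _ that] g(3) extremal_quotient_0[of \<alpha> A c] by simp
      then show ?thesis
        unfolding rotation_of_k_fun_iff A_def[symmetric] using c(1) f by auto
    qed
    ultimately show ?thesis by blast
  qed

  \<comment> \<open>The trivial rotation shows that the maximum is attained.\<close>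
  have "rotation_of (k_fun \<alpha> \<beta>) (k_fun \<alpha> \<beta>)"
    unfolding rotation_of_def by (rule exI[of _ 0]) simp
  then have "M \<in> (\<lambda>f. dirichlet_area \<rho> (z_over f)) ` F"
    using rotation by (metis image_eqI)
  moreover have "\<forall>a\<in>(\<lambda>f. dirichlet_area \<rho> (z_over f)) ` F. a \<le> M"
    using bound by blast
  moreover have "{f \<in> F. dirichlet_area \<rho> (z_over f) = M} = {f. rotation_of (k_fun \<alpha> \<beta>) f}"
    using rotation bound by blast
  ultimately show ?thesis unfolding is_maximum_def by blast
qed

end
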